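(* For every non-trivial finite Abelian group $G$ there exist a positive constant $\delta$ and a family $(\mathbb{A}_n)_{n\ge1}$ of unsatisfiable instances of $3\mathrm{LIN}(G)$, where $\mathbb{A}_n$ has $\Theta(n)$ variables and $\Theta(n)$ equations, such that for every sufficiently large $n$ every Polynomial Calculus refutation over the reals of $\mathrm{EQ}(\mathbb{A}_n,\mathbb{B}(G,3))$ has degree at least $\delta n$.
   Context: For a finite Abelian group $G$, $\mathbb{B}(G,3)$ is the structure with domain $G$ having one ternary relation symbol for each distinct relation of the form $\{(g_1,g_2,g_3)\in G^3:z_1g_1+z_2g_2+z_3g_3=g\}$ ($g\in G$, $z_i\in\mathbb{Z}$), interpreted as that relation; $3\mathrm{LIN}(G)=\mathrm{CSP}(\mathbb{B}(G,3))$, whose instances are finite structures in this vocabulary (systems of linear equations over $G$, three variable positions per equation); an instance is unsatisfiable if it has no homomorphism to $\mathbb{B}(G,3)$. $\mathrm{EQ}(\mathbb{A},\mathbb{B})$ is the system of polynomial equations over variables $X(a,b)$ and twins $\bar X(a,b)$ ($a\in A,b\in B$): $\prod_{b\in B}\bar X(a,b)=0$ for $a\in A$; $X(a,b_0)X(a,b_1)=0$ for $a\in A$, $b_0\ne b_1$; $\prod_{i=1}^rX(a_i,b_i)=0$ for each relation symbol $R$ of arity $r$, $(a_1,\dots,a_r)\in R(\mathbb{A})$, $(b_1,\dots,b_r)\in B^r\setminus R(\mathbb{B})$. Polynomial Calculus over $\mathbb{R}$: derive equations from these and the axioms $X^2-X=0$, $\bar X^2-\bar X=0$, $X+\bar X-1=0$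 by $P=0,Q=0\vdash P+Q=0$, $P=0\vdash cP=0$ ($c\in\mathbb{R}$), $P=0\vdash YP=0$ ($Y$ a variable or twin); a refutation derives $1=0$; its degree is the maximum total degree of a polynomial in it. *)

theory Defs
  imports
    "HOL-Algebra.Group"
    "HOL-Library.Poly_Mapping"
    "HOL-Library.Landau_Symbols"
    Complex_Main
begin

section \<open>Relational structures\<close>

text \<open>
  A vocabulary is a set \<open>\<sigma>\<close> of relation symbols together with an arity function; tuples
  are lists. The interpretation of a symbol outside \<open>\<sigma>\<close> is junk and is never looked at.
\<close>

record ('s, 'a) rel_structure =
  universe :: "'a set"
  interp :: "'s \<Rightarrow> 'a list set"

definition is_structure :: "'s set \<Rightarrow> ('s \<Rightarrow> nat) \<Rightarrow> ('s, 'a) rel_structure \<Rightarrow> bool" where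
  "is_structure \<sigma> ar A \<longleftrightarrow>
     (\<forall>R\<in>\<sigma>. interp A R \<subseteq> {t. length t = ar R \<and> set t \<subseteq> universe A})"

definition is_homomorphism ::
    "'s set \<Rightarrow> ('s, 'a) rel_structure \<Rightarrow> ('s, 'b) rel_structure \<Rightarrow> ('a \<Rightarrow> 'b) \<Rightarrow> bool" where
  "is_homomorphism \<sigma> A B h \<longleftrightarrow>
     h ` universe A \<subseteq> universe B \<and> (\<forall>R\<in>\<sigma>. \<forall>t\<in>interp A R. map h t \<in> interp B R)"

section \<open>Linear equations over a finite Abelian group\<close>

text \<open>
  Groups are written multiplicatively here: the solution set of
  \<open>z\<^sub>1 g\<^sub>1 + z\<^sub>2 g\<^sub>2 + z\<^sub>3 g\<^sub>3 = g\<close> is expressed with integer powers.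
\<close>

definition lin_rel ::
    "('g, 'm) monoid_scheme \<Rightarrow> int \<Rightarrow> int \<Rightarrow> int \<Rightarrow> 'g \<Rightarrow> 'g list set" where
  "lin_rel G z1 z2 z3 g =
     {[g1, g2, g3] | g1 g2 g3. g1 \<in> carrier G \<and> g2 \<in> carrier G \<and> g3 \<in> carrier G \<and>
        (g1 [^]\<^bsub>G\<^esub> z1) \<otimes>\<^bsub>G\<^esub> (g2 [^]\<^bsub>G\<^esub> z2) \<otimes>\<^bsub>G\<^esub> (g3 [^]\<^bsub>G\<^esub> z3) = g}"

text \<open>
  There is one symbol for each \<^emph>\<open>distinct\<close> relation, so the relations themselves serve as
  the (ternary) symbols, and the template interprets each of them as itself.
\<close>

definition lin_vocab :: "('g, 'm) monoid_scheme \<Rightarrow> 'g list set set" where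
  "lin_vocab G = {lin_rel G z1 z2 z3 g | z1 z2 z3 g. g \<in> carrier G}"

definition lin_arity :: "'g list set \<Rightarrow> nat" where
  "lin_arity R = 3"

definition lin_template :: "('g, 'm) monoid_scheme \<Rightarrow> ('g list set, 'g) rel_structure" where
  "lin_template G = \<lparr>universe = carrier G, interp = (\<lambda>R. R)\<rparr>"

lemma is_structure_lin_template: "is_structure (lin_vocab G) lin_arity (lin_template G)"
  by (auto simp: is_structure_def lin_vocab_def lin_arity_def lin_template_def lin_rel_def)

definition is_3LIN_instance ::
    "('g, 'm) monoid_scheme \<Rightarrow> ('g list set, 'a) rel_structure \<Rightarrow> bool" where
  "is_3LIN_instance G A \<longleftrightarrow>
     finite (universe A) \<and> is_structure (lin_vocab G) lin_arity A"

definition unsatisfiable_3LIN ::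
    "('g, 'm) monoid_scheme \<Rightarrow> ('g list set, 'a) rel_structure \<Rightarrow> bool" where
  "unsatisfiable_3LIN G A \<longleftrightarrow> \<not> (\<exists>h. is_homomorphism (lin_vocab G) A (lin_template G) h)"

text \<open>
  The variables of an instance are the elements of its universe; its equations are the pairs
  of a symbol and a tuple in the interpretation of that symbol.
\<close>

definition num_variables :: "('g list set, 'a) rel_structure \<Rightarrow> nat" where
  "num_variables A = card (universe A)"

definition num_equations ::
    "('g, 'm) monoid_scheme \<Rightarrow> ('g list set, 'a) rel_structure \<Rightarrow> nat" where
  "num_equations G A = card (SIGMA R : lin_vocab G. interp A R)"

section \<open>Real polynomials and the system EQ\<close>

datatype ('a, 'b) eqvar = X 'a 'b | Xbar 'a 'b

text \<open>Monomials are finitely supported exponent functions.\<close>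

type_synonym 'v rpoly = "('v \<Rightarrow>\<^sub>0 nat) \<Rightarrow>\<^sub>0 real"

definition pvar :: "'v \<Rightarrow> 'v rpoly" where
  "pvar v = Poly_Mapping.single (Poly_Mapping.single v 1) 1"

definition pconst :: "real \<Rightarrow> 'v rpoly" where
  "pconst c = Poly_Mapping.single 0 c"

definition monom_degree :: "('v \<Rightarrow>\<^sub>0 nat) \<Rightarrow> nat" where
  "monom_degree m = (\<Sum>v\<in>Poly_Mapping.keys m. Poly_Mapping.lookup m v)"

text \<open>The zero polynomial has degree 0.\<close>

definition total_degree :: "'v rpoly \<Rightarrow> nat" where
  "total_degree P = Max (insert 0 (monom_degree ` Poly_Mapping.keys P))"

text \<open>A polynomial \<open>P\<close> stands for the equation \<open>P = 0\<close>.\<close>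

definition EQ ::
    "'s set \<Rightarrow> ('s \<Rightarrow> nat) \<Rightarrow> ('s, 'a) rel_structure \<Rightarrow> ('s, 'b) rel_structure
      \<Rightarrow> ('a, 'b) eqvar rpoly set" where
  "EQ \<sigma> ar A B =
     {(\<Prod>b\<in>universe B. pvar (Xbar a b)) | a. a \<in> universe A}
   \<union> {pvar (X a b0) * pvar (X a b1) | a b0 b1.
        a \<in> universe A \<and> b0 \<in> universe B \<and> b1 \<in> universe B \<and> b0 \<noteq> b1}
   \<union> {(\<Prod>i<ar R. pvar (X (as ! i) (bs ! i))) | R as bs.
        R \<in> \<sigma> \<and> as \<in> interp A R \<and>
        length bs = ar R \<and> set bs \<subseteq> universe B \<and> bs \<notin> interp B R}"

section \<open>Polynomial Calculus over the reals\<close>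

definition EQ_vars :: "'a set \<Rightarrow> 'b set \<Rightarrow> ('a, 'b) eqvar set" where
  "EQ_vars A B = {X a b | a b. a \<in> A \<and> b \<in> B} \<union> {Xbar a b | a b. a \<in> A \<and> b \<in> B}"

definition PC_axioms :: "'a set \<Rightarrow> 'b set \<Rightarrow> ('a, 'b) eqvar rpoly set" where
  "PC_axioms A B =
     {pvar (X a b) ^ 2 - pvar (X a b) | a b. a \<in> A \<and> b \<in> B}
   \<union> {pvar (Xbar a b) ^ 2 - pvar (Xbar a b) | a b. a \<in> A \<and> b \<in> B}
   \<union> {pvar (X a b) + pvar (Xbar a b) - 1 | a b. a \<in> A \<and> b \<in> B}"

text \<open>
  Proofs are sequences of polynomials. The sets \<open>A\<close> and \<open>B\<close> delimit the variables available,
  and \<open>E\<close> is the set of hypotheses.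
\<close>

definition PC_derivation ::
    "'a set \<Rightarrow> 'b set \<Rightarrow> ('a, 'b) eqvar rpoly set \<Rightarrow> ('a, 'b) eqvar rpoly list \<Rightarrow> bool" where
  "PC_derivation A B E ps \<longleftrightarrow>
     (\<forall>i<length ps.
        ps ! i \<in> E \<union> PC_axioms A B
      \<or> (\<exists>j<i. \<exists>k<i. ps ! i = ps ! j + ps ! k)
      \<or> (\<exists>j<i. \<exists>c. ps ! i = pconst c * ps ! j)
      \<or> (\<exists>j<i. \<exists>v\<in>EQ_vars A B. ps ! i = pvar v * ps ! j))"

definition PC_refutation ::
    "'a set \<Rightarrow> 'b set \<Rightarrow> ('a, 'b) eqvar rpoly set \<Rightarrow> ('a, 'b) eqvar rpoly list \<Rightarrow> bool" where
  "PC_refutation A B E ps \<longleftrightarrow> PC_derivation A B E ps \<and> ps \<noteq> [] \<and> last ps = 1"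

definition PC_degree :: "'v rpoly list \<Rightarrow> nat" where
  "PC_degree ps = Max (total_degree ` set ps)"

end

theory Submission
  imports Defs "HOL-Library.Real_Mod" "HOL-Algebra.Multiplicative_Group"
begin

text \<open>
  Fix \<open>h \<noteq> \<one>\<close> in \<open>G\<close>, of order \<open>k\<close>, and consider equations \<open>x\<^sub>a x\<^sub>b x\<^sub>c = h\<^bsup>\<beta>\<^esup>\<close> whose columns form a
  random \<open>|G| n \<times> n\<close> incidence with three entries per row. A union bound makes every small
  set \<open>S\<close> of rows meet more than \<open>8|S|/5\<close> columns, hence have more than \<open>|S|/5\<close> columns met only once. Since
  \<open>k\<^bsup>|G|n\<^esup> > |G|\<^bsup>n\<^esup>\<close>, some choice of right-hand sides in the powers of \<open>h\<close> is unsatisfiable.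

  For the lower bound, evaluate polynomials at the assignments \<open>x\<^sub>v = h\<^bsup>j\<^esup>\<close> and expand the resulting
  functions in characters of \<open>\<int>\<^sub>k\<^bsup>n\<^esup>\<close>: degree bounds the weight of the characters. Let \<open>\<Lambda>\<close> be the
  linear functional sending the character \<open>\<gamma>\<close> to the value \<open>\<omega>\<^bsup>\<beta>\<cdot>c\<^esup>\<close> forced by a combination \<open>c\<close> of few
  rows with sum \<open>\<gamma>\<close>, and to \<open>0\<close> if there is none. By expansion a combination of low weight uses few
  rows, so on characters of low weight \<open>\<Lambda>\<close> is multiplicative in the sense of lemma \<open>lam_add\<close>. Therefore
  the polynomials \<open>P\<close> with \<open>\<Lambda>(\<chi> P) = 0\<close> for all characters \<open>\<chi>\<close> of weight at most the degree bound
  contain all axioms and are closed under the rules, but do not contain \<open>1\<close>.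
\<close>

section \<open>Expanding incidence structures\<close>

text \<open>A weak form of Stirling with 3 in place of \<open>exp 1\<close>: consecutive left-hand
  sides have ratio \<open>(t + 1) * (1 + 1 / t) ^ t\<close>, and the second factor is at most
  \<open>exp 1\<close>.\<close>

lemma power_self_le_fact: "real t ^ t \<le> 3 ^ t * fact t"
proof (induction t)
  case (Suc t)
  show ?case
  proof (cases "t = 0")
    case False
    have "(1 + 1 / real t) ^ t \<le> exp (1 / real t) ^ t"
      by (intro power_mono) auto
    also have "\<dots> = exp 1"
      using False by (simp flip: exp_of_nat_mult)
    also have "\<dots> \<le> (3 :: real)"
      by (rule exp_le)
    finally have *: "(1 + 1 / real t) ^ t \<le> 3" .
    have "real (Suc t) ^ Suc t = real (Suc t) * (real t * (1 + 1 / real t)) ^ t"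
      using False by (simp add: distrib_left add.commute)
    also have "\<dots> = real (Suc t) * (real t ^ t * (1 + 1 / real t) ^ t)"
      by (simp only: power_mult_distrib)
    also have "\<dots> \<le> real (Suc t) * ((3 ^ t * fact t) * 3)"
      by (intro mult_left_mono mult_mono Suc * ) auto
    also have "\<dots> = 3 ^ Suc t * fact (Suc t)"
      by simp
    finally show ?thesis .
  qed simp
qed simp

text \<open>The usual bound of the binomial coefficient by \<open>(3 * n / t) ^ t\<close>, with the
  denominator cleared so that \<open>t = 0\<close> is no exception.\<close>

lemma binomial_mult_power_le: "real (n choose t) * real t ^ t \<le> (3 * real n) ^ t"
proof -
  have "real (n choose t) * real t ^ t \<le> real (n choose t) * (3 ^ t * fact t)"
    by (intro mult_left_mono power_self_le_fact) auto
  also have "\<dots> = 3 ^ t * real ((n choose t) * fact t)"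
    by simp
  also have "\<dots> \<le> 3 ^ t * real (n ^ t)"
    by (intro mult_left_mono, unfold of_nat_le_iff, rule binomial_fact_pow) auto
  finally show ?thesis
    by (simp add: power_mult_distrib)
qed

text \<open>One term of the union bound: the choices of \<open>s\<close> rows and \<open>t\<close>
  columns, times the ways to place all entries of these rows in these columns. With \<rho> an upper
  bound for \<open>t / n\<close>, choosing the rows costs a factor \<open>\<rho> ^ s\<close> in the
  denominator, while columns and entries contribute \<open>\<rho> ^ (3 * s - t)\<close>. The surplus
  exponent \<open>2 * s - t\<close> is at least \<open>2 * s / 5\<close>, and \<rho> \<le>
  \<open>q ^ 5\<close> turns it into \<open>(q\<^sup>2) ^ s\<close>.\<close>

lemma nonexpanding_count_le:
  fixes q :: real
  assumes "1 \<le> s" "1 \<le> n" "0 < q" "q \<le> 1" "2 * real s \<le> q ^ 5 * real n" and t: "t = 8 * s div 5"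
  shows "real ((K * n) choose s) * real (n choose t) * real t ^ (3 * s)
           \<le> (54 * real K * q\<^sup>2) ^ s * real n ^ (3 * s)"
proof -
  define \<rho> where "\<rho> = 2 * real s / real n"
  have \<rho>: "0 < \<rho>" "\<rho> \<le> q ^ 5" and n\<rho>: "real n * \<rho> = 2 * real s"
    using assms by (auto simp: \<rho>_def field_simps)
  have t2: "t \<le> 2 * s"
    by (simp add: t)
  have "real ((K * n) choose s) * \<rho> ^ s = (real ((K * n) choose s) * real s ^ s) * (2 / real n) ^ s"
    by (simp add: \<rho>_def power_mult_distrib power_divide)
  also have "\<dots> \<le> (3 * real (K * n)) ^ s * (2 / real n) ^ s"
    by (intro mult_right_mono binomial_mult_power_le) auto
  also have "\<dots> = (3 * real (K * n) * (2 / real n)) ^ s"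
    by (simp only: power_mult_distrib)
  also have "3 * real (K * n) * (2 / real n) = 6 * real K"
    using assms by simp
  finally have a: "real ((K * n) choose s) * \<rho> ^ s \<le> (6 * real K) ^ s" .
  have "real (n choose t) * real t ^ (3 * s) = (real (n choose t) * real t ^ t) * real t ^ (3 * s - t)"
    using t2 by (simp flip: power_add)
  also have "\<dots> \<le> (3 * real n) ^ t * (real n * \<rho>) ^ (3 * s - t)"
    using t2 by (intro mult_mono binomial_mult_power_le power_mono) (auto simp: n\<rho>)
  also have "\<dots> = 3 ^ t * real n ^ (t + (3 * s - t)) * \<rho> ^ (3 * s - t)"
    by (simp add: power_mult_distrib power_add)
  also have "\<dots> \<le> 3 ^ (2 * s) * real n ^ (3 * s) * \<rho> ^ (3 * s - t)"
    using t2 \<rho> assms(2) by (intro mult_right_mono mult_mono power_increasing) auto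
  finally have b: "real (n choose t) * real t ^ (3 * s) \<le> 9 ^ s * real n ^ (3 * s) * \<rho> ^ (3 * s - t)"
    by (simp add: power_mult)
  have "\<rho> ^ (2 * s - t) \<le> (q ^ 5) ^ (2 * s - t)"
    using \<rho> by (intro power_mono) auto
  also have "\<dots> = q ^ (5 * (2 * s - t))"
    by (simp add: power_mult)
  also have "\<dots> \<le> q ^ (2 * s)"
    using assms by (intro power_decreasing) auto
  finally have c: "\<rho> ^ (2 * s - t) \<le> (q\<^sup>2) ^ s"
    by (simp add: power_mult)
  have "(real ((K * n) choose s) * real (n choose t) * real t ^ (3 * s)) * \<rho> ^ s
      = (real ((K * n) choose s) * \<rho> ^ s) * (real (n choose t) * real t ^ (3 * s))"
    by simp
  also have "\<dots> \<le> (6 * real K) ^ s * (9 ^ s * real n ^ (3 * s) * \<rho> ^ (3 * s - t))"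
    using \<rho> by (intro mult_mono a b) auto
  also have "\<rho> ^ (3 * s - t) = \<rho> ^ (2 * s - t) * \<rho> ^ s"
    using t2 by (simp flip: power_add)
  also have "(6 * real K) ^ s * (9 ^ s * real n ^ (3 * s) * (\<rho> ^ (2 * s - t) * \<rho> ^ s))
    \<le> (6 * real K) ^ s * (9 ^ s * real n ^ (3 * s) * ((q\<^sup>2) ^ s * \<rho> ^ s))"
    using \<rho> by (intro mult_left_mono mult_right_mono c) auto
  also have "\<dots> = ((54 * real K * q\<^sup>2) ^ s * real n ^ (3 * s)) * \<rho> ^ s"
  proof -
    have "54 * real K * q\<^sup>2 = 6 * real K * 9 * q\<^sup>2"
      by simp
    then show ?thesis
      by (simp only: power_mult_distrib mult_ac)
  qed
  finally show ?thesis
    using \<rho> by (simp add: mult_le_cancel_right)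
qed

lemma card_PiE_image_subset:
  assumes "S \<subseteq> {..<m}" "T \<subseteq> {..<n}"
  shows "card {f \<in> {..<m} \<times> {..<3} \<rightarrow>\<^sub>E {..<n}. f ` (S \<times> {..<3::nat}) \<subseteq> T}
           = card T ^ (3 * card S) * n ^ (3 * (m - card S))"
proof -
  have fin: "finite S"
    using assms(1) finite_subset by blast
  have "{f \<in> {..<m} \<times> {..<3} \<rightarrow>\<^sub>E {..<n}. f ` (S \<times> {..<3::nat}) \<subseteq> T}
      = (\<Pi>\<^sub>E p \<in> {..<m} \<times> {..<3}. if fst p \<in> S then T else {..<n})"
    (is "?L = ?R")
  proof (intro equalityI subsetI)
    fix f assume f: "f \<in> ?L"
    show "f \<in> ?R"
      using f by (intro PiE_I) (force simp: PiE_def extensional_def split: if_splits)+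
  next
    fix f assume f: "f \<in> ?R"
    have "f p \<in> {..<n}" if "p \<in> {..<m} \<times> {..<3}" for p
      using PiE_mem[OF f that] assms(2) by (auto split: if_splits)
    moreover have "f p \<in> T" if "p \<in> S \<times> {..<3}" for p
    proof -
      have "p \<in> {..<m} \<times> {..<3}"
        using that assms(1) by auto
      from PiE_mem[OF f this] show ?thesis
        using that by auto
    qed
    ultimately show "f \<in> ?L"
      using f by (auto simp: PiE_def)
  qed
  also have "card \<dots> = (\<Prod>p\<in>{..<m} \<times> {..<3::nat}. card (if fst p \<in> S then T else {..<n}))"
    by (rule card_PiE) auto
  also have "\<dots> = (\<Prod>i<m. \<Prod>j<3::nat. card (if i \<in> S then T else {..<n}))"
    by (simp only: prod.cartesian_product case_prod_unfold)
  also have "\<dots> = (\<Prod>i<m. if i \<in> S then card T ^ 3 else n ^ 3)"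
    by (intro prod.cong) auto
  also have "\<dots> = (card T ^ 3) ^ card S * (n ^ 3) ^ card ({..<m} - S)"
  proof -
    have "{..<m} \<inter> {x. x \<in> S} = S" "{..<m} \<inter> - {x. x \<in> S} = {..<m} - S"
      using assms by auto
    then show ?thesis
      by (simp add: prod.If_cases)
  qed
  also have "card ({..<m} - S) = m - card S"
    using assms fin by (simp add: card_Diff_subset)
  finally show ?thesis
    by (simp add: power_mult)
qed

lemma sum_half_powers: "(\<Sum>s=1..N. (1/2 :: real) ^ s) < 1"
proof -
  have "(\<Sum>s=1..N. (1/2 :: real) ^ s) = 1 - (1/2) ^ N"
    by (induction N) auto
  then show ?thesis
    by simp
qed

text \<open>First-moment counting over all incidences: the fraction violating expansion at some set
  of \<open>s\<close> rows is at most \<open>(1/2) ^ s\<close>, and these fractions sum to less than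
  1.\<close>

lemma exists_expanding_incidence:
  assumes "1 \<le> K"
  obtains \<delta> :: real where "0 < \<delta>" "\<And>n. 1 \<le> n \<Longrightarrow> \<exists>f \<in> {..<K * n} \<times> {..<3::nat} \<rightarrow>\<^sub>E {..<n}.
    \<forall>S\<subseteq>{..<K * n}. S \<noteq> {} \<longrightarrow> real (card S) \<le> \<delta> * real n \<longrightarrow>
      8 * card S < 5 * card (f ` (S \<times> {..<3}))"
proof -
  \<comment> \<open>This choice gives \<open>54 * K * q\<^sup>2 \<le> 1/2\<close>, the base of the
    geometric series. Below, \<open>\<delta> = q ^ 5 / 2\<close> turns
    \<open>s \<le> \<delta> * n\<close> into the hypothesis \<open>2 * s \<le> q ^ 5 * n\<close> of
    the counting bound.\<close>
  define q :: real where "q = 1 / (18 * real K)"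
  have q: "0 < q" "q \<le> 1" "54 * real K * q\<^sup>2 \<le> 1/2"
    using assms by (auto simp: q_def field_simps power2_eq_square)
  define \<delta> where "\<delta> = q ^ 5 / 2"
  have \<delta>: "0 < \<delta>" "\<delta> \<le> 1 / 2"
    using q by (auto simp: \<delta>_def power_le_one)
  have "\<exists>f \<in> {..<K * n} \<times> {..<3::nat} \<rightarrow>\<^sub>E {..<n}.
    \<forall>S\<subseteq>{..<K * n}. S \<noteq> {} \<longrightarrow> real (card S) \<le> \<delta> * real n \<longrightarrow>
      8 * card S < 5 * card (f ` (S \<times> {..<3}))" if n: "1 \<le> n" for n
  proof (rule ccontr)
    define m where "m = K * n"
    define A where "A = {..<m} \<times> {..<3::nat} \<rightarrow>\<^sub>E {..<n}"
    define N where "N = nat \<lfloor>\<delta> * real n\<rfloor>"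
    define t where "t s = 8 * s div 5" for s :: nat
    define bad where "bad S T = {f \<in> A. f ` (S \<times> {..<3::nat}) \<subseteq> T}" for S T
    define Ss where "Ss s = {S. S \<subseteq> {..<m} \<and> card S = s}" for s
    define Ts where "Ts s = {T. T \<subseteq> {..<n} \<and> card T = t s}" for s
    assume neg: "\<not> ?thesis"
    have finA: "finite A"
      by (auto simp: A_def intro!: finite_PiE)
    have cA: "card A = n ^ (3 * m)"
      by (simp add: A_def card_PiE mult.commute)
    have fin: "finite (Ss s)" "finite (Ts s)" for s
      by (auto simp: Ss_def Ts_def)
    have sN: "s \<le> N \<longleftrightarrow> real s \<le> \<delta> * real n" for s
      using \<delta> by (simp add: N_def le_nat_iff le_floor_iff)
    have Nm: "s \<le> m" "t s \<le> n" if "s \<le> N" for s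
    proof -
      have "real s \<le> \<delta> * real n"
        using that sN by simp
      also have "\<dots> \<le> 1 / 2 * real n"
        using \<delta> by (intro mult_right_mono) auto
      finally have "2 * s \<le> n"
        by linarith
      moreover have "n \<le> m"
        using assms by (simp add: m_def)
      ultimately show "s \<le> m" "t s \<le> n"
        by (auto simp: t_def)
    qed
    have "A \<subseteq> (\<Union>s\<in>{1..N}. \<Union>S\<in>Ss s. \<Union>T\<in>Ts s. bad S T)"
    proof
      fix f assume f: "f \<in> A"
      then obtain S where S: "S \<subseteq> {..<m}" "S \<noteq> {}" "real (card S) \<le> \<delta> * real n"
          "5 * card (f ` (S \<times> {..<3})) \<le> 8 * card S"
        using neg unfolding A_def m_def by (metis not_le)
      have "finite S"
        using S finite_subset by blast
      then have s: "card S \<in> {1..N}"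
        using S sN by (auto simp: Suc_le_eq card_gt_0_iff)
      have sub: "f ` (S \<times> {..<3}) \<subseteq> {..<n}"
        using f S(1) by (auto simp: A_def)
      moreover have "card (f ` (S \<times> {..<3})) \<le> t (card S)"
        using S(4) by (simp add: t_def less_eq_div_iff_mult_less_eq)
      \<comment> \<open>The image is enlarged to exactly \<open>t (card S)\<close> columns, so that
        only one size of \<open>T\<close> has to be counted for each size of \<open>S\<close>. There
        is room because \<delta> \<le> 1/2.\<close>
      ultimately obtain T where "f ` (S \<times> {..<3}) \<subseteq> T" "T \<subseteq> {..<n}" "card T = t (card S)"
        using exists_subset_between[of "f ` (S \<times> {..<3})" "t (card S)" "{..<n}"] Nm(2)[of "card S"] s
        by auto
      then have "f \<in> bad S T" "T \<in> Ts (card S)" "S \<in> Ss (card S)"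
        using f S(1) by (auto simp: bad_def Ss_def Ts_def)
      with s show "f \<in> (\<Union>s\<in>{1..N}. \<Union>S\<in>Ss s. \<Union>T\<in>Ts s. bad S T)"
        by blast
    qed
    then have "card A \<le> card (\<Union>s\<in>{1..N}. \<Union>S\<in>Ss s. \<Union>T\<in>Ts s. bad S T)"
      using fin finA by (intro card_mono) (auto simp: bad_def)
    also have "\<dots> \<le> (\<Sum>s=1..N. \<Sum>S\<in>Ss s. \<Sum>T\<in>Ts s. card (bad S T))"
      by (intro order.trans[OF card_UN_le] sum_mono fin) auto
    also have "\<dots> = (\<Sum>s=1..N. (m choose s) * (n choose t s) * (t s ^ (3 * s) * n ^ (3 * (m - s))))"
    proof (intro sum.cong refl)
      fix s
      have "(\<Sum>S\<in>Ss s. \<Sum>T\<in>Ts s. card (bad S T))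
          = (\<Sum>S\<in>Ss s. \<Sum>T\<in>Ts s. t s ^ (3 * s) * n ^ (3 * (m - s)))"
        by (intro sum.cong refl) (auto simp: bad_def A_def card_PiE_image_subset Ss_def Ts_def)
      also have "\<dots> = card (Ss s) * card (Ts s) * (t s ^ (3 * s) * n ^ (3 * (m - s)))"
        by simp
      also have "card (Ss s) = m choose s"
        by (simp add: Ss_def n_subsets)
      also have "card (Ts s) = n choose t s"
        by (simp add: Ts_def n_subsets)
      finally show "(\<Sum>S\<in>Ss s. \<Sum>T\<in>Ts s. card (bad S T))
        = (m choose s) * (n choose t s) * (t s ^ (3 * s) * n ^ (3 * (m - s)))" .
    qed
    finally have "real (card A)
        \<le> real (\<Sum>s=1..N. (m choose s) * (n choose t s) * (t s ^ (3 * s) * n ^ (3 * (m - s))))"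
      by (simp only: of_nat_le_iff)
    also have "\<dots> = (\<Sum>s=1..N. (real (m choose s) * real (n choose t s) * real (t s) ^ (3 * s))
        * real n ^ (3 * (m - s)))"
      by (simp add: mult_ac)
    also have "\<dots> \<le> (\<Sum>s=1..N. (1/2) ^ s * real n ^ (3 * m))"
    proof (intro sum_mono)
      fix s assume s: "s \<in> {1..N}"
      have "(real (m choose s) * real (n choose t s) * real (t s) ^ (3 * s)) * real n ^ (3 * (m - s))
          \<le> ((54 * real K * q\<^sup>2) ^ s * real n ^ (3 * s)) * real n ^ (3 * (m - s))"
        unfolding m_def using s n q sN[of s]
        by (intro mult_right_mono nonexpanding_count_le) (auto simp: t_def \<delta>_def)
      also have "\<dots> \<le> ((1/2) ^ s * real n ^ (3 * s)) * real n ^ (3 * (m - s))"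
        using q by (intro mult_right_mono power_mono) auto
      also have "\<dots> = (1/2) ^ s * real n ^ (3 * s + 3 * (m - s))"
        by (simp add: power_add)
      also have "3 * s + 3 * (m - s) = 3 * m"
        using s Nm(1)[of s] by simp
      finally show "(real (m choose s) * real (n choose t s) * real (t s) ^ (3 * s))
        * real n ^ (3 * (m - s)) \<le> (1/2) ^ s * real n ^ (3 * m)" .
    qed
    also have "\<dots> = (\<Sum>s=1..N. (1/2) ^ s) * real n ^ (3 * m)"
      by (simp add: sum_distrib_right)
    also have "\<dots> < 1 * real n ^ (3 * m)"
      using n by (intro mult_strict_right_mono sum_half_powers) auto
    finally show False
      by (simp add: cA)
  qed
  with \<delta>(1) that show ?thesis
    by blast
qed

section \<open>A functional annihilating low-degree consequences\<close>

text \<open>Row \<open>i\<close> has its entries in the columns \<open>col (i, 0)\<close>,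
  \<open>col (i, 1)\<close>, \<open>col (i, 2)\<close>, possibly with repetitions, and \<beta> holds
  the exponents of the right-hand sides. Combinations of at most \<open>s\<close> rows count as
  small; expansion is assumed up to \<open>2 * s\<close> because sums and differences of two small
  combinations occur.\<close>

locale expanding_system =
  fixes k n m s :: nat and col :: "nat \<times> nat \<Rightarrow> nat" and \<beta> :: "nat \<Rightarrow> int"
  assumes k_ge: "2 \<le> k"
    and s_ge: "1 \<le> s"
    and col_less: "\<And>i j. i < m \<Longrightarrow> j < 3 \<Longrightarrow> col (i, j) < n"
    and expanding: "\<And>S. S \<subseteq> {..<m} \<Longrightarrow> S \<noteq> {} \<Longrightarrow> card S \<le> 2 * s \<Longrightarrow>
          8 * card S < 5 * card (col ` (S \<times> {..<3}))"
begin

text \<open>Coefficient vectors are integral; only their residues modulo \<open>k\<close> matter.\<close>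

definition comb :: "(nat \<Rightarrow> int) \<Rightarrow> nat \<Rightarrow> int" where
  "comb c v = (\<Sum>p\<in>{..<m} \<times> {..<3}. if col p = v then c (fst p) else 0)"

definition wt :: "(nat \<Rightarrow> int) \<Rightarrow> nat" where
  "wt \<alpha> = card {v. v < n \<and> \<not> int k dvd \<alpha> v}"

definition csupp :: "(nat \<Rightarrow> int) \<Rightarrow> nat set" where
  "csupp c = {i. i < m \<and> \<not> int k dvd c i}"

lemma finite_csupp [simp]: "finite (csupp c)"
  by (simp add: csupp_def)

text \<open>Double counting of the \<open>3 * card S\<close> entries: each column met only once
  takes one, every other column at least two. Expansion then leaves many columns met once, and there
  the combination has a single coefficient that is nonzero modulo \<open>k\<close>.\<close>

lemma csupp_le_wt_comb:
  assumes "card (csupp c) \<le> 2 * s"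
  shows "card (csupp c) \<le> 5 * wt (comb c)"
proof (cases "csupp c = {}")
  case False
  define S where "S = csupp c"
  define P where "P = S \<times> {..<3::nat}"
  define N where "N = col ` P"
  define fib where "fib v = {p \<in> P. col p = v}" for v
  \<comment> \<open>A column met only once by the support cannot cancel.\<close>
  define U where "U = {v \<in> N. card (fib v) = 1}"
  have S: "S \<subseteq> {..<m}" "finite S"
    by (auto simp: S_def csupp_def)
  have fin: "finite P" "finite N" "finite (fib v)" for v
    using S by (auto simp: P_def N_def fib_def)
  have exp: "8 * card S < 5 * card N"
    unfolding N_def P_def by (rule expanding) (use S assms False in \<open>auto simp: S_def\<close>)
  have "3 * card S = card P"
    by (simp add: P_def card_cartesian_product)
  also have "P = (\<Union>v\<in>N. fib v)"
    by (auto simp: N_def fib_def)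
  also have "card \<dots> = (\<Sum>v\<in>N. card (fib v))"
    by (rule card_UN_disjoint) (auto simp: fin, auto simp: fib_def)
  also have "\<dots> \<ge> (\<Sum>v\<in>N. if v \<in> U then 1 else 2)"
  proof (intro sum_mono)
    fix v assume v: "v \<in> N"
    then have "fib v \<noteq> {}"
      by (auto simp: N_def fib_def)
    then have "card (fib v) \<noteq> 0"
      using fin by simp
    then show "(if v \<in> U then 1 else 2) \<le> card (fib v)"
      using v by (auto simp: U_def)
  qed
  also have "(\<Sum>v\<in>N. if v \<in> U then 1 else 2 :: nat) = card U + 2 * card (N - U)"
  proof -
    have "N \<inter> {v. v \<in> U} = U" "N \<inter> - {v. v \<in> U} = N - U"
      by (auto simp: U_def)
    then show ?thesis
      using fin by (simp add: sum.If_cases)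
  qed
  also have "card (N - U) = card N - card U"
    using fin by (intro card_Diff_subset) (auto simp: U_def)
  finally have "card U + 2 * (card N - card U) \<le> 3 * card S" .
  \<comment> \<open>From \<open>2 * card N - card U \<le> 3 * card S\<close> and
    \<open>5 * card N > 8 * card S\<close> follows
    \<open>5 * card U > 16 * card S - 15 * card S\<close>.\<close>
  with exp have "card S \<le> 5 * card U"
    by linarith
  also have "card U \<le> wt (comb c)"
    unfolding wt_def
  proof (intro card_mono subsetI)
    fix v assume v: "v \<in> U"
    then obtain p where p: "fib v = {p}"
      by (auto simp: U_def card_1_singleton_iff)
    then have pP: "p \<in> P" "col p = v"
      by (auto simp: fib_def)
    have pm: "p \<in> {..<m} \<times> {..<3}"
      using pP S by (auto simp: P_def)
    have "comb c v = c (fst p) +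
        (\<Sum>p\<in>{..<m} \<times> {..<3} - {p}. if col p = v then c (fst p) else 0)"
      unfolding comb_def using pm pP by (subst sum.remove[of _ p]) auto
    \<comment> \<open>Any further entry in column \<open>v\<close> belongs to a row outside the
      support, whose coefficient vanishes modulo \<open>k\<close>.\<close>
    moreover have "int k dvd (\<Sum>p\<in>{..<m} \<times> {..<3} - {p}. if col p = v then c (fst p) else 0)"
    proof (intro dvd_sum)
      fix r assume r: "r \<in> {..<m} \<times> {..<3} - {p}"
      show "int k dvd (if col r = v then c (fst r) else 0)"
      proof (cases "col r = v")
        case True
        have "r \<notin> P"
          using p r True by (auto simp: fib_def)
        then show ?thesis
          using r by (auto simp: P_def S_def csupp_def)
      qed simp
    qed
    moreover have "\<not> int k dvd c (fst p)"
      using pP by (auto simp: P_def S_def csupp_def)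
    ultimately have "\<not> int k dvd comb c v"
      by (simp add: dvd_add_left_iff)
    moreover have "v < n"
      using pP(2) pm col_less[of "fst p" "snd p"] by auto
    ultimately show "v \<in> {v. v < n \<and> \<not> int k dvd comb c v}"
      by simp
  qed simp
  finally show ?thesis
    by (simp add: S_def)
qed simp

section \<open>Roots of unity and characters of the integers modulo \<open>k\<close>\<close>

definition \<omega> :: "int \<Rightarrow> complex" where
  "\<omega> z = cis (2 * pi * real_of_int z / real k)"

lemma \<omega>_add: "\<omega> (a + b) = \<omega> a * \<omega> b"
  by (simp add: \<omega>_def cis_mult add_divide_distrib distrib_left)

lemma \<omega>_0 [simp]: "\<omega> 0 = 1"
  by (simp add: \<omega>_def)

lemma \<omega>_nonzero [simp]: "\<omega> a \<noteq> 0"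
  by (simp add: \<omega>_def)

lemma \<omega>_eq_1_iff: "\<omega> a = 1 \<longleftrightarrow> int k dvd a"
proof -
  have "\<omega> a = 1 \<longleftrightarrow> (\<exists>z. 2 * pi * real_of_int a / real k = real_of_int z * (2 * pi))"
    by (simp add: \<omega>_def cis_eq_1_iff)
  also have "\<dots> \<longleftrightarrow> (\<exists>z. real_of_int a = real_of_int (z * int k))"
    using k_ge by (simp add: field_simps)
  also have "\<dots> \<longleftrightarrow> int k dvd a"
    unfolding of_int_eq_iff by (auto simp: dvd_def mult.commute)
  finally show ?thesis .
qed

lemma \<omega>_eq_iff: "\<omega> a = \<omega> b \<longleftrightarrow> int k dvd a - b"
proof -
  have "\<omega> a = \<omega> (a - b) * \<omega> b"
    by (simp flip: \<omega>_add)
  then show ?thesis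
    by (simp flip: \<omega>_eq_1_iff)
qed

text \<open>Orthogonality on the cyclic group: a geometric sum whose ratio is a \<open>k\<close>-th
  root of unity.\<close>

lemma sum_\<omega>: "(\<Sum>j<k. \<omega> (a * int j)) = (if int k dvd a then of_nat k else 0)"
proof -
  have pow: "\<omega> (a * int j) = \<omega> a ^ j" for j
    by (induction j) (simp_all add: distrib_left \<omega>_add)
  show ?thesis
  proof (cases "int k dvd a")
    case False
    then have "\<omega> a \<noteq> 1"
      by (simp add: \<omega>_eq_1_iff)
    moreover have "\<omega> a ^ k = 1"
      by (simp flip: pow add: \<omega>_eq_1_iff)
    ultimately show ?thesis
      using False by (simp add: pow geometric_sum)
  qed (simp add: pow flip: \<omega>_eq_1_iff)
qed

section \<open>Values forced by combinations of few rows\<close>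

definition rep :: "(nat \<Rightarrow> int) \<Rightarrow> (nat \<Rightarrow> int) \<Rightarrow> bool" where
  "rep \<gamma> c \<longleftrightarrow> (\<forall>v<n. int k dvd \<gamma> v - comb c v)"

text \<open>The exponent of \<open>h\<close> on the right-hand side of the combined
  equation.\<close>

definition charge :: "(nat \<Rightarrow> int) \<Rightarrow> int" where
  "charge c = (\<Sum>i<m. c i * \<beta> i)"

text \<open>The choice of \<open>c\<close> is irrelevant by lemma \<open>lam_eq\<close>, a consequence of expansion.\<close>

definition lam :: "(nat \<Rightarrow> int) \<Rightarrow> complex" where
  "lam \<gamma> = (if \<exists>c. card (csupp c) \<le> s \<and> rep \<gamma> c
            then \<omega> (charge (SOME c. card (csupp c) \<le> s \<and> rep \<gamma> c)) else 0)"

lemma comb_add: "comb (\<lambda>i. c i + d i) v = comb c v + comb d v"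
  unfolding comb_def sum.distrib[symmetric] by (intro sum.cong) auto

lemma comb_diff: "comb (\<lambda>i. c i - d i) v = comb c v - comb d v"
  unfolding comb_def sum_subtractf[symmetric] by (intro sum.cong) auto

lemma charge_add: "charge (\<lambda>i. c i + d i) = charge c + charge d"
  by (simp add: charge_def distrib_right sum.distrib)

lemma charge_diff: "charge (\<lambda>i. c i - d i) = charge c - charge d"
  by (simp add: charge_def left_diff_distrib sum_subtractf)

lemma card_csupp_add: "card (csupp (\<lambda>i. c i + d i)) \<le> card (csupp c) + card (csupp d)"
proof -
  have "csupp (\<lambda>i. c i + d i) \<subseteq> csupp c \<union> csupp d"
    by (auto simp: csupp_def)
  then have "card (csupp (\<lambda>i. c i + d i)) \<le> card (csupp c \<union> csupp d)"
    by (intro card_mono) auto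
  also have "\<dots> \<le> card (csupp c) + card (csupp d)"
    by (rule card_Un_le)
  finally show ?thesis .
qed

lemma card_csupp_diff: "card (csupp (\<lambda>i. c i - d i)) \<le> card (csupp c) + card (csupp d)"
proof -
  have "csupp (\<lambda>i. - d i) = csupp d"
    by (simp add: csupp_def)
  then show ?thesis
    using card_csupp_add[of c "\<lambda>i. - d i"] by simp
qed

lemma rep_add:
  assumes "rep \<gamma> c" "rep \<gamma>' d"
  shows "rep (\<lambda>v. \<gamma> v + \<gamma>' v) (\<lambda>i. c i + d i)"
  unfolding rep_def comb_add add_diff_add using assms by (simp add: rep_def)

lemma rep_diff:
  assumes "rep \<gamma> c" "rep \<gamma>' d"
  shows "rep (\<lambda>v. \<gamma> v - \<gamma>' v) (\<lambda>i. c i - d i)"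
  unfolding rep_def comb_diff
proof (intro allI impI)
  fix v assume v: "v < n"
  have "\<gamma> v - \<gamma>' v - (comb c v - comb d v) = (\<gamma> v - comb c v) - (\<gamma>' v - comb d v)"
    by simp
  also have "int k dvd \<dots>"
    by (rule dvd_diff) (use assms v in \<open>simp_all add: rep_def\<close>)
  finally show "int k dvd \<gamma> v - \<gamma>' v - (comb c v - comb d v)" .
qed

text \<open>A self-improvement: the a priori bound \<open>2 * s\<close>, which holds for a sum or
  difference of two small combinations, drops to \<open>5 * wt \<gamma>\<close>. For \<gamma> of
  weight at most \<open>s / 5\<close> the combination is therefore small again.\<close>

lemma csupp_le_wt:
  assumes "rep \<gamma> c" "card (csupp c) \<le> 2 * s"
  shows "card (csupp c) \<le> 5 * wt \<gamma>"
proof -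
  have "int k dvd \<gamma> v \<longleftrightarrow> int k dvd comb c v" if "v < n" for v
    using dvd_add_right_iff[of "int k" "\<gamma> v - comb c v" "comb c v"] assms(1) that
    by (simp add: rep_def)
  then have "wt (comb c) = wt \<gamma>"
    unfolding wt_def by (intro arg_cong[of _ _ card]) auto
  with csupp_le_wt_comb[OF assms(2)] show ?thesis
    by simp
qed

text \<open>Two small representations of \<gamma> differ by a representation of 0 with support at
  most \<open>2 * s\<close>. Weight 0 makes that support empty, so the charges agree modulo
  \<open>k\<close>.\<close>

lemma lam_eq:
  assumes "card (csupp c) \<le> s" "rep \<gamma> c"
  shows "lam \<gamma> = \<omega> (charge c)"
proof -
  define d where "d = (SOME c. card (csupp c) \<le> s \<and> rep \<gamma> c)"
  have d: "card (csupp d) \<le> s \<and> rep \<gamma> d"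
    unfolding d_def by (rule someI[of _ c]) (use assms in simp)
  have "rep (\<lambda>v. \<gamma> v - \<gamma> v) (\<lambda>i. c i - d i)"
    using rep_diff assms d by blast
  moreover have "card (csupp (\<lambda>i. c i - d i)) \<le> 2 * s"
    using card_csupp_diff[of c d] assms d by simp
  ultimately have "card (csupp (\<lambda>i. c i - d i)) \<le> 5 * wt (\<lambda>v. \<gamma> v - \<gamma> v)"
    by (rule csupp_le_wt)
  then have "csupp (\<lambda>i. c i - d i) = {}"
    by (simp add: wt_def)
  then have "int k dvd charge (\<lambda>i. c i - d i)"
    unfolding charge_def by (intro dvd_sum) (auto simp: csupp_def)
  then have "\<omega> (charge c) = \<omega> (charge d)"
    by (simp add: \<omega>_eq_iff charge_diff)
  then show ?thesis
    using assms by (auto simp: lam_def d_def)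
qed

lemma lam_nonzero_obtains:
  assumes "lam \<gamma> \<noteq> 0"
  obtains c where "card (csupp c) \<le> s" "rep \<gamma> c" "lam \<gamma> = \<omega> (charge c)"
  using assms lam_eq by (metis lam_def)

lemma lam_0: "lam (\<lambda>v. 0) = 1"
proof -
  have "rep (\<lambda>v. 0) (\<lambda>i. 0)" "card (csupp (\<lambda>i. 0)) \<le> s" "charge (\<lambda>i. 0) = 0"
    by (auto simp: rep_def comb_def csupp_def charge_def)
  then show ?thesis
    using lam_eq by fastforce
qed

text \<open>A small representation of \<gamma> plus one of \<gamma>' represents the sum; conversely,
  one of the sum minus one of \<gamma>' represents \<gamma>. In both directions the result has
  support at most \<open>2 * s\<close>, and the weight bound on the vector it represents makes it
  small. Hence \<open>lam\<close> vanishes at \<gamma> iff it vanishes at the sum.\<close>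

lemma lam_add:
  assumes "lam \<gamma>' \<noteq> 0" "5 * wt \<gamma> \<le> s" "5 * wt (\<lambda>v. \<gamma> v + \<gamma>' v) \<le> s"
  shows "lam (\<lambda>v. \<gamma> v + \<gamma>' v) = lam \<gamma> * lam \<gamma>'"
proof -
  obtain d where d: "card (csupp d) \<le> s" "rep \<gamma>' d" "lam \<gamma>' = \<omega> (charge d)"
    using assms(1) by (rule lam_nonzero_obtains)
  show ?thesis
  proof (cases "lam \<gamma> = 0")
    case False
    then obtain c where c: "card (csupp c) \<le> s" "rep \<gamma> c" "lam \<gamma> = \<omega> (charge c)"
      by (rule lam_nonzero_obtains)
    have r: "rep (\<lambda>v. \<gamma> v + \<gamma>' v) (\<lambda>i. c i + d i)"
      using c d rep_add by blast
    moreover have "card (csupp (\<lambda>i. c i + d i)) \<le> 2 * s"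
      using card_csupp_add[of c d] c d by simp
    ultimately have "card (csupp (\<lambda>i. c i + d i)) \<le> s"
      using csupp_le_wt assms(3) by fastforce
    from lam_eq[OF this r] show ?thesis
      by (simp add: c d charge_add \<omega>_add)
  next
    case True
    have "lam (\<lambda>v. \<gamma> v + \<gamma>' v) = 0"
    proof (rule ccontr)
      assume "\<not> ?thesis"
      then obtain c where c: "card (csupp c) \<le> s" "rep (\<lambda>v. \<gamma> v + \<gamma>' v) c"
        by (rule lam_nonzero_obtains)
      have r: "rep \<gamma> (\<lambda>i. c i - d i)"
        using rep_diff[OF c(2) d(2)] by simp
      moreover have "card (csupp (\<lambda>i. c i - d i)) \<le> 2 * s"
        using card_csupp_diff[of c d] c d by simp
      ultimately have "card (csupp (\<lambda>i. c i - d i)) \<le> s"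
        using csupp_le_wt assms(2) by fastforce
      from lam_eq[OF this r] True show False
        by simp
    qed
    with True show ?thesis
      by simp
  qed
qed

definition row :: "nat \<Rightarrow> nat \<Rightarrow> int" where
  "row i v = (\<Sum>j<3. if col (i, j) = v then 1 else 0)"

text \<open>The unit vector \<open>e\<close> represents the row, and its support of size at most 1
  is small as 1 \<le> \<open>s\<close>.\<close>

lemma lam_row:
  assumes "i < m"
  shows "lam (row i) = \<omega> (\<beta> i)"
proof -
  define e where "e = (\<lambda>i'. if i' = i then 1 else 0 :: int)"
  have "csupp e \<subseteq> {i}"
    by (auto simp: e_def csupp_def)
  then have "card (csupp e) \<le> card {i}"
    by (intro card_mono) auto
  then have "card (csupp e) \<le> s"
    using s_ge by simp
  moreover have "comb e v = row i v" for v
  proof -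
    have "comb e v = (\<Sum>i'<m. \<Sum>j<3. if i' = i then if col (i', j) = v then 1 else 0 else 0)"
      unfolding comb_def sum.cartesian_product by (intro sum.cong) (auto simp: e_def)
    also have "\<dots> = (\<Sum>i'<m. if i' = i then row i v else 0)"
      by (intro sum.cong) (auto simp: row_def)
    finally show ?thesis
      using assms by simp
  qed
  then have "rep (row i) e"
    by (simp add: rep_def)
  moreover have "charge e = \<beta> i"
    using assms by (simp add: charge_def e_def if_distrib[of "\<lambda>x. x * _"] cong: if_cong)
  ultimately show ?thesis
    using lam_eq by metis
qed

lemma lam_cong:
  assumes "\<And>v. v < n \<Longrightarrow> int k dvd \<gamma> v - \<gamma>' v"
  shows "lam \<gamma> = lam \<gamma>'"
proof -
  have "rep \<gamma> c \<longleftrightarrow> rep \<gamma>' c" for c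
  proof -
    have "int k dvd \<gamma> v - comb c v \<longleftrightarrow> int k dvd \<gamma>' v - comb c v" if "v < n" for v
      using dvd_add_right_iff[OF assms[OF that], of "\<gamma>' v - comb c v"] by simp
    then show ?thesis
      by (auto simp: rep_def)
  qed
  then show ?thesis
    by (simp add: lam_def)
qed

lemma wt_add: "wt (\<lambda>v. \<alpha> v + \<gamma> v) \<le> wt \<alpha> + wt \<gamma>"
proof -
  have "wt (\<lambda>v. \<alpha> v + \<gamma> v)
      \<le> card ({v. v < n \<and> \<not> int k dvd \<alpha> v} \<union> {v. v < n \<and> \<not> int k dvd \<gamma> v})"
    unfolding wt_def by (intro card_mono) auto
  also have "\<dots> \<le> wt \<alpha> + wt \<gamma>"
    unfolding wt_def by (rule card_Un_le)
  finally show ?thesis .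
qed

lemma wt_uminus [simp]: "wt (\<lambda>v. - \<alpha> v) = wt \<alpha>"
  by (simp add: wt_def)

lemma wt_diff: "wt (\<lambda>v. \<alpha> v - \<gamma> v) \<le> wt \<alpha> + wt \<gamma>"
  using wt_add[of \<alpha> "\<lambda>v. - \<gamma> v"] by simp

section \<open>Fourier analysis on the assignments\<close>

definition chr :: "(nat \<Rightarrow> int) \<Rightarrow> (nat \<Rightarrow> nat) \<Rightarrow> complex" where
  "chr \<alpha> x = (\<Prod>v<n. \<omega> (\<alpha> v * int (x v)))"

lemma chr_add: "chr (\<lambda>v. \<alpha> v + \<gamma> v) x = chr \<alpha> x * chr \<gamma> x"
  by (simp add: chr_def distrib_right \<omega>_add prod.distrib)

lemma chr_0 [simp]: "chr (\<lambda>v. 0) x = 1"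
  by (simp add: chr_def)

definition \<Omega> :: "(nat \<Rightarrow> nat) set" where
  "\<Omega> = {..<n} \<rightarrow>\<^sub>E {..<k}"

text \<open>The kernel is the inverse Fourier transform of \<open>lam\<close>, see lemma \<open>Lam_chr\<close>.\<close>

definition Lam :: "((nat \<Rightarrow> nat) \<Rightarrow> complex) \<Rightarrow> complex" where
  "Lam F = (\<Sum>x\<in>\<Omega>. F x * (\<Sum>y\<in>\<Omega>. lam (\<lambda>v. int (y v)) * chr (\<lambda>v. - int (y v)) x / of_nat k ^ n))"

lemma Lam_add: "Lam (\<lambda>x. F x + H x) = Lam F + Lam H"
  by (simp add: Lam_def distrib_right sum.distrib)

lemma Lam_scale: "Lam (\<lambda>x. c * F x) = c * Lam F"
  by (simp add: Lam_def sum_distrib_left mult.assoc)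

lemma Lam_0 [simp]: "Lam (\<lambda>x. 0) = 0"
  by (simp add: Lam_def)

lemma sum_chr: "(\<Sum>x\<in>\<Omega>. chr \<alpha> x) = (if \<forall>v<n. int k dvd \<alpha> v then of_nat k ^ n else 0)"
proof -
  have "(\<Sum>x\<in>\<Omega>. chr \<alpha> x) = (\<Prod>v<n. \<Sum>j<k. \<omega> (\<alpha> v * int j))"
    unfolding \<Omega>_def chr_def by (subst prod_sum_PiE) auto
  also have "\<dots> = (\<Prod>v<n. if int k dvd \<alpha> v then of_nat k else 0)"
    by (simp add: sum_\<omega>)
  also have "\<dots> = (if \<forall>v<n. int k dvd \<alpha> v then of_nat k ^ n else 0)"
    by (auto intro!: prod_zero)
  finally show ?thesis .
qed

text \<open>Fourier inversion: by orthogonality only the reduced representative \<open>y0\<close> of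
  \<gamma> survives in the kernel, and \<open>lam\<close> depends on residues only.\<close>

lemma Lam_chr: "Lam (chr \<gamma>) = lam \<gamma>"
proof -
  define y0 where "y0 = (\<lambda>v\<in>{..<n}. nat (\<gamma> v mod int k))"
  have k0: "0 < k"
    using k_ge by simp
  have y0: "y0 \<in> \<Omega>"
    using k0 by (auto simp: y0_def \<Omega>_def nat_less_iff)
  have y0_iff: "(\<forall>v<n. int k dvd \<gamma> v - int (y v)) \<longleftrightarrow> y = y0" if "y \<in> \<Omega>" for y
  proof
    assume *: "\<forall>v<n. int k dvd \<gamma> v - int (y v)"
    show "y = y0"
    proof (rule PiE_ext[OF that[unfolded \<Omega>_def] y0[unfolded \<Omega>_def]])
      fix v assume v: "v \<in> {..<n}"
      then have "\<gamma> v mod int k = int (y v) mod int k"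
        using * by (simp add: mod_eq_dvd_iff)
      also have "\<dots> = int (y v)"
        using PiE_mem[OF that[unfolded \<Omega>_def] v] by simp
      finally show "y v = y0 v"
        using v by (simp add: y0_def)
    qed
  next
    assume "y = y0"
    then show "\<forall>v<n. int k dvd \<gamma> v - int (y v)"
      using k0 by (auto simp: y0_def)
  qed
  have fin: "finite \<Omega>"
    by (auto simp: \<Omega>_def intro!: finite_PiE)
  have "Lam (chr \<gamma>) = (\<Sum>x\<in>\<Omega>. \<Sum>y\<in>\<Omega>. lam (\<lambda>v. int (y v)) / of_nat k ^ n * chr (\<lambda>v. \<gamma> v - int (y v)) x)"
    unfolding Lam_def sum_distrib_left diff_conv_add_uminus chr_add
    by (intro sum.cong refl) simp
  also have "\<dots> = (\<Sum>y\<in>\<Omega>. lam (\<lambda>v. int (y v)) / of_nat k ^ n * (\<Sum>x\<in>\<Omega>. chr (\<lambda>v. \<gamma> v - int (y v)) x))"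
    by (subst sum.swap) (simp add: sum_distrib_left)
  also have "\<dots> = (\<Sum>y\<in>\<Omega>. if y = y0 then lam (\<lambda>v. int (y v)) else 0)"
    using k0 by (intro sum.cong refl) (auto simp: sum_chr y0_iff)
  also have "\<dots> = lam (\<lambda>v. int (y0 v))"
    using fin y0 by simp
  also have "\<dots> = lam \<gamma>"
    using y0_iff[OF y0] by (intro lam_cong) (simp add: dvd_diff_commute)
  finally show ?thesis .
qed

section \<open>Functions of bounded weight and closure under the proof rules\<close>

inductive span :: "nat \<Rightarrow> ((nat \<Rightarrow> nat) \<Rightarrow> complex) \<Rightarrow> bool" for d where
  span_chr: "wt \<alpha> \<le> d \<Longrightarrow> span d (chr \<alpha>)"
| span_0: "span d (\<lambda>x. 0)"
| span_add: "span d F \<Longrightarrow> span d H \<Longrightarrow> span d (\<lambda>x. F x + H x)"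
| span_scale: "span d F \<Longrightarrow> span d (\<lambda>x. c * F x)"

lemma span_mono:
  assumes "span d F" "d \<le> e"
  shows "span e F"
  using assms(1) by induction (use assms(2) in \<open>auto intro: span.intros\<close>)

lemma span_const: "span d (\<lambda>x. c)"
proof -
  have "span d (chr (\<lambda>v. 0))"
    by (intro span_chr) (simp add: wt_def)
  from span_scale[OF this, of c] show ?thesis
    by simp
qed

lemma span_sum: "(\<And>i. i \<in> I \<Longrightarrow> span d (F i)) \<Longrightarrow> span d (\<lambda>x. \<Sum>i\<in>I. F i x)"
  by (induction I rule: infinite_finite_induct) (simp_all add: span_0 span_add)

lemma span_mult:
  assumes "span d F" "span e H"
  shows "span (d + e) (\<lambda>x. F x * H x)"
  using assms(1)
proof induction
  case (span_chr \<alpha>)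
  show ?case
    using assms(2)
  proof induction
    case (span_chr \<gamma>)
    have "span (d + e) (chr (\<lambda>v. \<alpha> v + \<gamma> v))"
      using wt_add[of \<alpha> \<gamma>] span_chr \<open>wt \<alpha> \<le> d\<close> by (intro span.span_chr) simp
    moreover have "chr (\<lambda>v. \<alpha> v + \<gamma> v) = (\<lambda>x. chr \<alpha> x * chr \<gamma> x)"
      by (intro ext chr_add)
    ultimately show ?case
      by simp
  next
    case (span_scale H c)
    then show ?case
      using span.span_scale[of "d + e" "\<lambda>x. chr \<alpha> x * H x" c] by (simp add: mult.left_commute)
  qed (simp_all add: distrib_left span_0 span_add)
next
  case (span_scale F c)
  then show ?case
    using span.span_scale[of "d + e" "\<lambda>x. F x * H x" c] by (simp add: mult.assoc)
qed (simp_all add: distrib_right span_0 span_add)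

text \<open>The minus sign makes \<open>Lam\<close> of a character \<gamma> tested against \<alpha>
  equal to \<open>lam\<close> of the difference of \<gamma> and \<alpha>; nonvanishing of this value
  is the relation between characters used below.\<close>

definition good :: "nat \<Rightarrow> ((nat \<Rightarrow> nat) \<Rightarrow> complex) \<Rightarrow> bool" where
  "good d F \<longleftrightarrow> (\<forall>\<alpha>. wt \<alpha> \<le> d \<longrightarrow> Lam (\<lambda>x. chr (\<lambda>v. - \<alpha> v) x * F x) = 0)"

lemma good_add: "good d F \<Longrightarrow> good d H \<Longrightarrow> good d (\<lambda>x. F x + H x)"
  by (simp add: good_def distrib_left Lam_add)

lemma good_scale: "good d F \<Longrightarrow> good d (\<lambda>x. c * F x)"
  by (simp add: good_def mult.left_commute Lam_scale)

lemma not_good_1: "\<not> good d (\<lambda>x. 1)"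
proof
  assume "good d (\<lambda>x. 1)"
  moreover have "wt (\<lambda>v. 0) \<le> d"
    by (simp add: wt_def)
  ultimately have "Lam (\<lambda>x. chr (\<lambda>v. - 0) x * 1) = 0"
    unfolding good_def by blast
  also have "(\<lambda>x. chr (\<lambda>v. - 0) x * 1) = chr (\<lambda>v. 0)"
    by (intro ext) simp
  finally show False
    by (simp only: Lam_chr lam_0) simp
qed

text \<open>
  The weight may exceed the one allowed in \<open>good\<close> by one: either no character occurring in \<open>F\<close> is
  related to \<open>\<alpha>\<close>, or \<open>\<alpha>\<close> can be exchanged for a related character of weight at most \<open>d\<close>.
\<close>

lemma good_step:
  assumes F: "span d F" "good d F" and d: "5 * (2 * d + 1) \<le> s" and \<alpha>: "wt \<alpha> \<le> d + 1"
  shows "Lam (\<lambda>x. chr (\<lambda>v. - \<alpha> v) x * F x) = 0"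
proof (cases "\<exists>\<alpha>'. wt \<alpha>' \<le> d \<and> lam (\<lambda>v. \<alpha>' v - \<alpha> v) \<noteq> 0")
  case True
  then obtain \<alpha>' where \<alpha>': "wt \<alpha>' \<le> d" "lam (\<lambda>v. \<alpha>' v - \<alpha> v) \<noteq> 0"
    by blast
  \<comment> \<open>Both sides are linear in \<open>F\<close>, so a single character \<gamma>
    suffices. There \<open>lam_add\<close> splits \<gamma> - \<alpha> through \<alpha>'; the two
    differences from \<gamma> have weights at most \<open>2 * d\<close> and
    \<open>2 * d + 1\<close>, whence the hypothesis on \<open>s\<close>.\<close>
  have "Lam (\<lambda>x. chr (\<lambda>v. - \<alpha> v) x * F x)
      = lam (\<lambda>v. \<alpha>' v - \<alpha> v) * Lam (\<lambda>x. chr (\<lambda>v. - \<alpha>' v) x * F x)"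
    using F(1)
  proof induction
    case (span_chr \<gamma>)
    have "wt (\<lambda>v. \<gamma> v - \<alpha>' v) \<le> 2 * d"
      using wt_diff[of \<gamma> \<alpha>'] span_chr \<alpha>' by simp
    moreover have "wt (\<lambda>v. \<gamma> v - \<alpha> v) \<le> 2 * d + 1"
      using wt_diff[of \<gamma> \<alpha>] span_chr \<alpha> by simp
    ultimately have "lam (\<lambda>v. \<gamma> v - \<alpha> v) = lam (\<lambda>v. \<gamma> v - \<alpha>' v) * lam (\<lambda>v. \<alpha>' v - \<alpha> v)"
      using lam_add[OF \<alpha>'(2), of "\<lambda>v. \<gamma> v - \<alpha>' v"] d by simp
    then show ?case
      using Lam_chr[of "\<lambda>v. - \<alpha> v + \<gamma> v"] Lam_chr[of "\<lambda>v. - \<alpha>' v + \<gamma> v"]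
      by (simp flip: chr_add add: mult.commute)
  qed (simp_all add: distrib_left Lam_add mult.left_commute Lam_scale)
  then show ?thesis
    using F(2) \<alpha>'(1) by (simp add: good_def)
next
  case False
  \<comment> \<open>Each character spanning \<open>F\<close> has weight at most \<open>d\<close>,
    hence is unrelated to \<alpha> and contributes 0.\<close>
  show ?thesis
    using F(1)
  proof induction
    case (span_chr \<gamma>)
    then show ?case
      using False Lam_chr[of "\<lambda>v. - \<alpha> v + \<gamma> v"] by (simp flip: chr_add)
  qed (simp_all add: distrib_left Lam_add mult.left_commute Lam_scale)
qed

text \<open>Multiplying by a character of weight at most 1 shifts the test character by weight at
  most 1, which is exactly the slack granted by \<open>good_step\<close>.\<close>

lemma good_mult:
  assumes "span d F" "good d F" "5 * (2 * d + 1) \<le> s" "span 1 H"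
  shows "good d (\<lambda>x. H x * F x)"
  using assms(4)
proof induction
  case (span_chr \<gamma>)
  show ?case
    unfolding good_def
  proof (intro allI impI)
    fix \<alpha> assume \<alpha>: "wt \<alpha> \<le> d"
    have w: "wt (\<lambda>v. \<alpha> v - \<gamma> v) \<le> d + 1"
      using wt_diff[of \<alpha> \<gamma>] \<alpha> span_chr by linarith
    have "chr (\<lambda>v. - \<alpha> v) x * (chr \<gamma> x * F x) = chr (\<lambda>v. - (\<alpha> v - \<gamma> v)) x * F x" for x
      using chr_add[of "\<lambda>v. - \<alpha> v" \<gamma> x] by simp
    then show "Lam (\<lambda>x. chr (\<lambda>v. - \<alpha> v) x * (chr \<gamma> x * F x)) = 0"
      using good_step[OF assms(1-3) w] by (simp only:)
  qed
next
  case span_0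
  then show ?case by (simp add: good_def)
next
  case (span_add F' H')
  then show ?case by (simp add: distrib_right good_add)
next
  case (span_scale F' c)
  then show ?case by (simp add: mult.assoc good_scale)
qed

lemma wt_row: "wt (row i) \<le> 3"
proof -
  have "{v. v < n \<and> \<not> int k dvd row i v} \<subseteq> (\<lambda>j. col (i, j)) ` {..<3}"
  proof
    fix v assume "v \<in> {v. v < n \<and> \<not> int k dvd row i v}"
    then have "row i v \<noteq> 0"
      by auto
    moreover have "row i v = 0" if "\<forall>j<3. col (i, j) \<noteq> v"
      unfolding row_def using that by (intro sum.neutral) auto
    ultimately obtain j where "j < 3" "col (i, j) = v"
      by blast
    then show "v \<in> (\<lambda>j. col (i, j)) ` {..<3}"
      by auto
  qed
  then have "wt (row i) \<le> card ((\<lambda>j. col (i, j)) ` {..<3})"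
    unfolding wt_def by (intro card_mono) auto
  also have "\<dots> \<le> card {..<3::nat}"
    by (rule card_image_le) simp
  finally show ?thesis
    by simp
qed

lemma chr_row:
  assumes "i < m"
  shows "chr (row i) x = \<omega> (\<Sum>j<3. int (x (col (i, j))))"
proof -
  have hom: "\<omega> (\<Sum>i\<in>I. f i) = (\<Prod>i\<in>I. \<omega> (f i))" for I :: "nat set" and f
    by (induction I rule: infinite_finite_induct) (simp_all add: \<omega>_add)
  have "(\<Sum>v<n. row i v * int (x v)) = (\<Sum>v<n. \<Sum>j<3. if col (i, j) = v then int (x v) else 0)"
    unfolding row_def sum_distrib_right by (intro sum.cong) auto
  also have "\<dots> = (\<Sum>j<3. \<Sum>v<n. if col (i, j) = v then int (x v) else 0)"
    by (rule sum.swap)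
  also have "\<dots> = (\<Sum>j<3. int (x (col (i, j))))"
    using col_less[OF assms] by (intro sum.cong) auto
  finally show ?thesis
    by (simp add: chr_def flip: hom)
qed

text \<open>Multiplication by the character of row \<open>i\<close> acts on \<open>F\<close> as \<open>z\<close> but under \<open>Lam\<close> as \<open>\<omega> (\<beta> i)\<close>.\<close>

lemma good_axiom:
  assumes i: "i < m" and F: "span 3 F" and d: "5 * (d + 6) \<le> s"
    and supp: "\<And>x. F x \<noteq> 0 \<Longrightarrow> \<omega> (\<Sum>j<3. int (x (col (i, j)))) = z" and z: "z \<noteq> \<omega> (\<beta> i)"
  shows "good d F"
  unfolding good_def
proof (intro allI impI)
  fix \<alpha> assume \<alpha>: "wt \<alpha> \<le> d"
  have "z * Lam (\<lambda>x. chr (\<lambda>v. - \<alpha> v) x * F x) = Lam (\<lambda>x. chr (\<lambda>v. - \<alpha> v) x * (chr (row i) x * F x))"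
  proof -
    have "chr (\<lambda>v. - \<alpha> v) x * (chr (row i) x * F x) = z * (chr (\<lambda>v. - \<alpha> v) x * F x)" for x
      using supp[of x] chr_row[OF i, of x] by (cases "F x = 0") auto
    then show ?thesis
      by (simp only: Lam_scale)
  qed
  \<comment> \<open>For a character \<gamma> of weight at most 3, the differences from \<alpha>
    before and after adding the row have weights at most \<open>d + 3\<close> and
    \<open>d + 6\<close>, so \<open>lam_add\<close> applies with the nonzero value
    \<open>lam (row i)\<close>.\<close>
  also have "\<dots> = \<omega> (\<beta> i) * Lam (\<lambda>x. chr (\<lambda>v. - \<alpha> v) x * F x)"
    using F
  proof induction
    case (span_chr \<gamma>)
    have w1: "wt (\<lambda>v. \<gamma> v - \<alpha> v) \<le> d + 3"
      using wt_diff[of \<gamma> \<alpha>] span_chr \<alpha> by simp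
    have "wt (\<lambda>v. (\<gamma> v - \<alpha> v) + row i v) \<le> d + 6"
      using wt_add[of "\<lambda>v. \<gamma> v - \<alpha> v" "row i"] w1 wt_row[of i] by simp
    then have "lam (\<lambda>v. (\<gamma> v - \<alpha> v) + row i v) = lam (\<lambda>v. \<gamma> v - \<alpha> v) * \<omega> (\<beta> i)"
      using lam_add[of "row i" "\<lambda>v. \<gamma> v - \<alpha> v"] d w1 by (simp add: lam_row[OF i])
    then show ?case
      using Lam_chr[of "\<lambda>v. - \<alpha> v + (row i v + \<gamma> v)"] Lam_chr[of "\<lambda>v. - \<alpha> v + \<gamma> v"]
      by (simp flip: chr_add add: algebra_simps)
  qed (simp_all add: distrib_left Lam_add mult.left_commute Lam_scale)
  finally show "Lam (\<lambda>x. chr (\<lambda>v. - \<alpha> v) x * F x) = 0"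
    using z by simp
qed

text \<open>The Fourier expansion of the indicator of a residue class in one coordinate uses only
  characters supported on that coordinate.\<close>

lemma span_indicator:
  assumes "a < n"
  shows "span 1 (\<lambda>x. if int k dvd int (x a) - j then 1 else 0)"
proof -
  define e where "e c = (\<lambda>v. if v = a then int c else 0)" for c :: nat
  have "{v. v < n \<and> \<not> int k dvd e c v} \<subseteq> {a}" for c
    by (auto simp: e_def)
  then have "wt (e c) \<le> card {a}" for c
    unfolding wt_def by (intro card_mono) auto
  then have "span 1 (\<lambda>x. \<Sum>c<k. \<omega> (- (j * int c)) / of_nat k * chr (e c) x)"
    by (intro span_sum span_scale span_chr) simp
  moreover have "(\<Sum>c<k. \<omega> (- (j * int c)) / of_nat k * chr (e c) x)
      = (if int k dvd int (x a) - j then 1 else 0)" for x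
  proof -
    have chr: "chr (e c) x = \<omega> (int (x a) * int c)" for c
    proof -
      have "chr (e c) x = (\<Prod>v<n. if v = a then \<omega> (int (x a) * int c) else 1)"
        unfolding chr_def by (intro prod.cong) (auto simp: e_def mult.commute)
      then show ?thesis
        using assms by simp
    qed
    have "(\<Sum>c<k. \<omega> (- (j * int c)) / of_nat k * chr (e c) x)
        = (\<Sum>c<k. \<omega> ((int (x a) - j) * int c)) / of_nat k"
      unfolding sum_divide_distrib chr
      by (intro sum.cong refl) (simp flip: \<omega>_add add: algebra_simps)
    then show ?thesis
      using k_ge by (simp add: sum_\<omega>)
  qed
  ultimately show ?thesis
    by simp
qed

end

section \<open>Evaluation of polynomials\<close>

definition meval :: "('v \<Rightarrow> real) \<Rightarrow> ('v \<Rightarrow>\<^sub>0 nat) \<Rightarrow> real" where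
  "meval \<nu> m = (\<Prod>v\<in>Poly_Mapping.keys m. \<nu> v ^ Poly_Mapping.lookup m v)"

definition peval :: "('v \<Rightarrow> real) \<Rightarrow> 'v rpoly \<Rightarrow> real" where
  "peval \<nu> P = (\<Sum>m\<in>Poly_Mapping.keys P. Poly_Mapping.lookup P m * meval \<nu> m)"

lemma meval_superset:
  assumes "finite K" "Poly_Mapping.keys m \<subseteq> K"
  shows "meval \<nu> m = (\<Prod>v\<in>K. \<nu> v ^ Poly_Mapping.lookup m v)"
  unfolding meval_def using assms by (intro prod.mono_neutral_left) (auto simp: in_keys_iff)

lemma meval_add: "meval \<nu> (a + b) = meval \<nu> a * meval \<nu> b"
proof -
  define K where "K = Poly_Mapping.keys a \<union> Poly_Mapping.keys b"
  have K: "finite K" "Poly_Mapping.keys a \<subseteq> K" "Poly_Mapping.keys b \<subseteq> K" "Poly_Mapping.keys (a + b) \<subseteq> K"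
    using keys_add[of a b] by (auto simp: K_def)
  show ?thesis
    unfolding meval_superset[OF K(1,2)] meval_superset[OF K(1,3)] meval_superset[OF K(1,4)]
    by (simp add: lookup_add power_add prod.distrib)
qed

lemma peval_add: "peval \<nu> (P + Q) = peval \<nu> P + peval \<nu> Q"
  unfolding peval_def by (rule setsum_keys_plus_distrib) (simp_all add: distrib_right)

lemma peval_single: "peval \<nu> (Poly_Mapping.single m c) = c * meval \<nu> m"
  by (cases "c = 0") (simp_all add: peval_def)

lemma peval_0 [simp]: "peval \<nu> 0 = 0"
  by (simp add: peval_def)

text \<open>Every polynomial is a sum of monomials, so additive statements about evaluation reduce
  to \<open>Poly_Mapping.single\<close>.\<close>

lemma poly_mapping_add_induct [case_names zero single add]:
  fixes P :: "'a \<Rightarrow>\<^sub>0 'b::comm_monoid_add"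
  assumes "Q 0" "\<And>m c. Q (Poly_Mapping.single m c)" "\<And>f g. Q f \<Longrightarrow> Q g \<Longrightarrow> Q (f + g)"
  shows "Q P"
proof (induction P rule: Poly_Mapping.update_induct)
  case (update f a b)
  have "Poly_Mapping.update a b f = Poly_Mapping.single a b + f"
    by (rule poly_mapping_eqI)
      (use update in \<open>auto simp: lookup_update lookup_add lookup_single when_def in_keys_iff\<close>)
  then show ?case
    using assms update by metis
qed (fact assms(1))

lemma peval_mult: "peval \<nu> (P * Q) = peval \<nu> P * peval \<nu> Q"
proof (induction P rule: poly_mapping_add_induct)
  case (single m c)
  show ?case
    by (induction Q rule: poly_mapping_add_induct)
      (simp_all add: mult_single peval_single meval_add distrib_left peval_add)
qed (simp_all add: distrib_right peval_add)

lemma peval_1 [simp]: "peval \<nu> 1 = 1"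
  using peval_single[of \<nu> 0 1] by (simp add: meval_def)

lemma peval_pconst [simp]: "peval \<nu> (pconst c) = c"
  by (simp add: pconst_def peval_single meval_def)

lemma peval_pvar [simp]: "peval \<nu> (pvar v) = \<nu> v"
  by (simp add: pvar_def peval_single meval_def)

lemma peval_diff: "peval \<nu> (P - Q) = peval \<nu> P - peval \<nu> Q"
  using peval_add[of \<nu> "P - Q" Q] by simp

lemma peval_power: "peval \<nu> (P ^ i) = peval \<nu> P ^ i"
  by (induction i) (simp_all add: peval_mult)

lemma peval_prod: "peval \<nu> (\<Prod>i\<in>I. P i) = (\<Prod>i\<in>I. peval \<nu> (P i))"
  by (induction I rule: infinite_finite_induct) (simp_all add: peval_mult)

section \<open>Degree-bounded proofs under evaluation\<close>

context expanding_system
begin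

lemma span_power:
  assumes "span 1 F"
  shows "span e (\<lambda>x. F x ^ e)"
proof (induction e)
  case 0
  show ?case using span_const[of 0 1] by simp
next
  case (Suc e)
  show ?case using span_mult[OF assms Suc] by simp
qed

lemma span_prod:
  assumes "finite I" "\<And>i. i \<in> I \<Longrightarrow> span (e i) (F i)"
  shows "span (\<Sum>i\<in>I. e i) (\<lambda>x. \<Prod>i\<in>I. F i x)"
  using assms
proof (induction I)
  case empty
  show ?case using span_const[of 0 1] by simp
next
  case (insert a I)
  then show ?case using span_mult[of "e a" "F a" "\<Sum>i\<in>I. e i" "\<lambda>x. \<Prod>i\<in>I. F i x"] by simp
qed

text \<open>The link between degree and weight: each variable evaluates into \<open>span 1\<close>,
  and weights add under products.\<close>

lemma span_peval:
  assumes "\<And>v. span 1 (\<lambda>x. of_real (val x v))"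
  shows "span (total_degree P) (\<lambda>x. of_real (peval (val x) P))"
proof -
  have mon: "span (total_degree P) (\<lambda>x. of_real (Poly_Mapping.lookup P m) * of_real (meval (val x) m))"
    if m: "m \<in> Poly_Mapping.keys P" for m
  proof (rule span_scale, rule span_mono)
    have "span (\<Sum>v\<in>Poly_Mapping.keys m. Poly_Mapping.lookup m v)
        (\<lambda>x. \<Prod>v\<in>Poly_Mapping.keys m. of_real (val x v) ^ Poly_Mapping.lookup m v)"
      by (intro span_prod span_power assms) auto
    then show "span (monom_degree m) (\<lambda>x. of_real (meval (val x) m))"
      by (simp add: monom_degree_def meval_def)
    show "monom_degree m \<le> total_degree P"
      unfolding total_degree_def using m by (intro Max_ge) auto
  qed
  show ?thesis
    using span_sum[OF mon] by (simp add: peval_def)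
qed

lemma no_PC_refutation:
  assumes ref: "PC_refutation A B E ps"
    and val: "\<And>v. span 1 (\<lambda>x. of_real (val x v))"
    and ax: "\<And>P x. P \<in> PC_axioms A B \<Longrightarrow> peval (val x) P = 0"
    and E: "\<And>P. P \<in> E \<Longrightarrow> good (PC_degree ps) (\<lambda>x. of_real (peval (val x) P))"
    and s: "5 * (2 * PC_degree ps + 1) \<le> s"
  shows False
proof -
  define d where "d = PC_degree ps"
  have sp: "span d (\<lambda>x. of_real (peval (val x) (ps ! i)))" if "i < length ps" for i
    using that unfolding d_def PC_degree_def
    by (intro span_mono[OF span_peval[OF val]] Max_ge) auto
  have good: "good d (\<lambda>x. of_real (peval (val x) (ps ! i)))" if "i < length ps" for i
    using that
  proof (induction i rule: less_induct)
    case (less i)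
    have "ps ! i \<in> E \<union> PC_axioms A B
      \<or> (\<exists>j<i. \<exists>k<i. ps ! i = ps ! j + ps ! k)
      \<or> (\<exists>j<i. \<exists>c. ps ! i = pconst c * ps ! j)
      \<or> (\<exists>j<i. \<exists>v\<in>EQ_vars A B. ps ! i = pvar v * ps ! j)"
      using ref less.prems unfolding PC_refutation_def PC_derivation_def by blast
    then consider "ps ! i \<in> E" | "ps ! i \<in> PC_axioms A B"
      | j l where "j < i" "l < i" "ps ! i = ps ! j + ps ! l"
      | j c where "j < i" "ps ! i = pconst c * ps ! j"
      | j v where "j < i" "ps ! i = pvar v * ps ! j"
      by blast
    then show ?case
    proof cases
      case 1
      then show ?thesis using E by (simp add: d_def)
    next
      case 2
      then show ?thesis by (simp add: ax good_def)
    next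
      case 3
      then show ?thesis
        using good_add[OF less.IH[of j] less.IH[of l]] less.prems by (simp add: peval_add)
    next
      case 4
      then show ?thesis
        using good_scale[OF less.IH[of j]] less.prems by (simp add: peval_mult)
    next
      case 5
      then show ?thesis
        using good_mult[OF sp[of j] less.IH[of j] _ val[of v]] less.prems s
        by (simp add: peval_mult d_def)
    qed
  qed
  have "ps \<noteq> []" "last ps = 1"
    using ref by (simp_all add: PC_refutation_def)
  then have "good d (\<lambda>x. 1)"
    using good[of "length ps - 1"] by (simp add: last_conv_nth)
  then show False
    using not_good_1 by blast
qed

end

section \<open>Instances over a group\<close>

text \<open>Rows with the same right-hand side share a symbol, and those with the same columns as
  well collapse to one equation; counting equations therefore asks for distinct column
  triples.\<close>

definition lin_instance ::
    "('g, 'm) monoid_scheme \<Rightarrow> nat \<Rightarrow> nat \<Rightarrow> (nat \<times> nat \<Rightarrow> nat) \<Rightarrow> (nat \<Rightarrow> 'g)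
      \<Rightarrow> ('g list set, nat) rel_structure" where
  "lin_instance G n m col r =
     \<lparr>universe = {..<n},
      interp = (\<lambda>R. {[col (i, 0), col (i, 1), col (i, 2)] | i. i < m \<and> R = lin_rel G 1 1 1 (r i)})\<rparr>"

lemma is_3LIN_instance_lin_instance:
  assumes "\<And>i j. i < m \<Longrightarrow> j < 3 \<Longrightarrow> col (i, j) < n"
  shows "is_3LIN_instance G (lin_instance G n m col r)"
  using assms by (auto simp: is_3LIN_instance_def is_structure_def lin_instance_def lin_arity_def)

lemma lin_rel_in_vocab: "g \<in> carrier G \<Longrightarrow> lin_rel G z1 z2 z3 g \<in> lin_vocab G"
  unfolding lin_vocab_def by blast

lemma num_equations_lin_instance:
  assumes "\<And>i. i < m \<Longrightarrow> r i \<in> carrier G"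
    and "inj_on (\<lambda>i. [col (i, 0), col (i, 1), col (i, 2)]) {..<m}"
  shows "num_equations G (lin_instance G n m col r) = m"
proof -
  have "(SIGMA R : lin_vocab G. interp (lin_instance G n m col r) R)
      = (\<lambda>i. (lin_rel G 1 1 1 (r i), [col (i, 0), col (i, 1), col (i, 2)])) ` {..<m}"
    using assms(1) by (auto simp: lin_instance_def lin_rel_in_vocab)
  moreover have "inj_on (\<lambda>i. (lin_rel G 1 1 1 (r i), [col (i, 0), col (i, 1), col (i, 2)])) {..<m}"
    using assms(2) by (auto simp: inj_on_def)
  ultimately show ?thesis
    by (simp add: num_equations_def card_image)
qed

context comm_group
begin

lemma lin_rel_111:
  "lin_rel G 1 1 1 g = {[a, b, c] | a b c. a \<in> carrier G \<and> b \<in> carrier G \<and> c \<in> carrier G \<and> a \<otimes> b \<otimes> c = g}"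
  unfolding lin_rel_def by auto

lemma nat_pow_eq_iff:
  assumes "h \<in> carrier G"
  shows "h [^] (a :: nat) = h [^] (b :: nat) \<longleftrightarrow> int (ord h) dvd int a - int b"
  using int_pow_eq[OF assms, of "int b" "int a"] by (auto simp: int_pow_int)

lemma exists_unsatisfiable_rhs:
  assumes fin: "finite (carrier G)" and h: "h \<in> carrier G" "h \<noteq> \<one>"
    and n: "1 \<le> n" and col: "\<And>i j. i < card (carrier G) * n \<Longrightarrow> j < 3 \<Longrightarrow> col (i, j) < n"
  obtains b :: "nat \<Rightarrow> nat" where
    "unsatisfiable_3LIN G (lin_instance G n (card (carrier G) * n) col (\<lambda>i. h [^] b i))"
proof -
  define K where "K = card (carrier G)"
  define m where "m = K * n"
  define k where "k = ord h"
  define B where "B = {..<m} \<rightarrow>\<^sub>E {..<k}"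
  define Y where "Y = {..<n} \<rightarrow>\<^sub>E carrier G"
  define sol where "sol g b \<longleftrightarrow>
    (\<forall>i<m. g (col (i, 0)) \<otimes> g (col (i, 1)) \<otimes> g (col (i, 2)) = h [^] b i)" for g and b :: "nat \<Rightarrow> nat"
  have k: "2 \<le> k"
    using ord_ge_1[OF fin h(1)] ord_eq_1[OF h(1)] h(2) by (simp add: k_def)
  have K: "0 < K"
    using fin h(1) by (auto simp: K_def card_gt_0_iff)
  have "\<exists>b\<in>B. \<forall>g\<in>Y. \<not> sol g b"
  proof (rule ccontr)
    assume "\<not> ?thesis"
    then obtain \<phi> where \<phi>: "\<And>b. b \<in> B \<Longrightarrow> \<phi> b \<in> Y" "\<And>b. b \<in> B \<Longrightarrow> sol (\<phi> b) b"
      by metis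
    \<comment> \<open>An assignment determines all left-hand sides, hence the powers of
      \<open>h\<close>, hence the exponents below the order of \<open>h\<close>.\<close>
    have "inj_on \<phi> B"
    proof (rule inj_onI)
      fix b b' assume b: "b \<in> B" "b' \<in> B" "\<phi> b = \<phi> b'"
      show "b = b'"
      proof (rule PiE_ext[OF b(1,2)[unfolded B_def]])
        fix i assume i: "i \<in> {..<m}"
        then have "h [^] b i = h [^] b' i"
          using \<phi>(2)[OF b(1)] \<phi>(2)[OF b(2)] b(3) by (simp add: sol_def)
        moreover have "b i < k" "b' i < k"
          using b i by (auto simp: B_def)
        ultimately show "b i = b' i"
          using nat_pow_eq_iff[OF h(1), of "b i" "b' i"]
          by (metis k_def mod_eq_dvd_iff mod_less of_nat_eq_iff of_nat_mod)
      qed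
    qed
    moreover have "finite Y"
      using fin by (auto simp: Y_def intro!: finite_PiE)
    ultimately have "card B \<le> card Y"
      using \<phi>(1) by (intro card_inj_on_le[of \<phi>]) auto
    then have "k ^ m \<le> K ^ n"
      by (simp add: B_def Y_def card_PiE K_def)
    \<comment> \<open>This is where \<open>K\<close> rows per variable are enough: right-hand sides
      outnumber assignments.\<close>
    moreover have "K ^ n < (k ^ K) ^ n"
    proof (rule power_strict_mono)
      have "K < 2 ^ K"
        by (rule less_exp)
      also have "\<dots> \<le> k ^ K"
        using k by (intro power_mono) auto
      finally show "K < k ^ K" .
    qed (use n in auto)
    ultimately show False
      by (simp add: m_def power_mult)
  qed
  then obtain b where b: "\<And>g. g \<in> Y \<Longrightarrow> \<not> sol g b"
    by blast
  have "unsatisfiable_3LIN G (lin_instance G n m col (\<lambda>i. h [^] b i))"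
    unfolding unsatisfiable_3LIN_def
  proof
    assume "\<exists>g. is_homomorphism (lin_vocab G) (lin_instance G n m col (\<lambda>i. h [^] b i)) (lin_template G) g"
    then obtain g where g: "is_homomorphism (lin_vocab G) (lin_instance G n m col (\<lambda>i. h [^] b i)) (lin_template G) g"
      by blast
    have "sol (restrict g {..<n}) b"
      unfolding sol_def
    proof (intro allI impI)
      fix i assume i: "i < m"
      have "lin_rel G 1 1 1 (h [^] b i) \<in> lin_vocab G"
        using h(1) by (intro lin_rel_in_vocab) simp
      moreover have "[col (i, 0), col (i, 1), col (i, 2)]
          \<in> interp (lin_instance G n m col (\<lambda>i. h [^] b i)) (lin_rel G 1 1 1 (h [^] b i))"
        using i by (auto simp: lin_instance_def)
      ultimately have "map g [col (i, 0), col (i, 1), col (i, 2)] \<in> lin_rel G 1 1 1 (h [^] b i)"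
        using g unfolding is_homomorphism_def lin_template_def by fastforce
      moreover have "col (i, j) < n" if "j < 3" for j
        using col[of i j] i that by (simp add: m_def K_def)
      ultimately show "restrict g {..<n} (col (i, 0)) \<otimes> restrict g {..<n} (col (i, 1))
          \<otimes> restrict g {..<n} (col (i, 2)) = h [^] b i"
        by (auto simp: lin_rel_111)
    qed
    moreover have "restrict g {..<n} \<in> Y"
      using g by (auto simp: Y_def is_homomorphism_def lin_instance_def lin_template_def)
    ultimately show False
      using b by blast
  qed
  with that show ?thesis
    by (simp add: m_def K_def)
qed

text \<open>Polynomials are evaluated only at assignments by powers of \<open>h\<close>. The
  constants 10 and 30 cover both weight conditions, \<open>5 * (2 * d + 1) \<le> s\<close> for
  multiplication and \<open>5 * (d + 6) \<le> s\<close> for the equations.\<close>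

lemma PC_degree_lower_bound:
  fixes b :: "nat \<Rightarrow> nat"
  assumes fin: "finite (carrier G)" and h: "h \<in> carrier G" "h \<noteq> \<one>"
    and col: "\<And>i j. i < m \<Longrightarrow> j < 3 \<Longrightarrow> col (i, j) < n"
    and expanding: "\<And>S. S \<subseteq> {..<m} \<Longrightarrow> S \<noteq> {} \<Longrightarrow> card S \<le> 2 * s \<Longrightarrow>
          8 * card S < 5 * card (col ` (S \<times> {..<3}))"
    and ref: "PC_refutation {..<n} (carrier G)
      (EQ (lin_vocab G) lin_arity (lin_instance G n m col (\<lambda>i. h [^] b i)) (lin_template G)) ps"
  shows "s < 10 * PC_degree ps + 30"
proof (rule ccontr)
  define k where "k = ord h"
  define d where "d = PC_degree ps"
  assume "\<not> ?thesis"
  then have s: "10 * d + 30 \<le> s"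
    by (simp add: d_def)
  have k: "2 \<le> k"
    using ord_ge_1[OF fin h(1)] ord_eq_1[OF h(1)] h(2) by (simp add: k_def)
  interpret expanding_system k n m s col "\<lambda>i. int (b i)"
    by standard (use k s col expanding in auto)
  \<comment> \<open>Variables with \<open>a \<ge> n\<close> get the constants 0 and 1, since
    membership in \<open>span 1\<close> is required of every variable and not only of those in
    \<open>EQ_vars\<close>.\<close>
  define val where "val x v = (case v of
      X a g \<Rightarrow> if a < n \<and> h [^] x a = g then 1 else (0::real)
    | Xbar a g \<Rightarrow> if a < n \<and> h [^] x a = g then 0 else 1)" for x :: "nat \<Rightarrow> nat" and v :: "(nat, 'a) eqvar"
  have val_X: "span 1 (\<lambda>x. of_real (val x (X a g)))" for a g
  proof (cases "a < n \<and> (\<exists>j::nat. h [^] j = g)")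
    case True
    then obtain j :: nat where "a < n" "h [^] j = g"
      by blast
    then show ?thesis
      using span_indicator[of a "int j"] nat_pow_eq_iff[OF h(1), of _ j, folded k_def]
      by (auto simp: val_def if_distrib cong: if_cong)
  next
    case False
    then have "(\<lambda>x. complex_of_real (val x (X a g))) = (\<lambda>x. 0)"
      by (auto simp: val_def)
    then show ?thesis
      by (simp add: span_0)
  qed
  have val_span: "span 1 (\<lambda>x. of_real (val x v))" for v
  proof (cases v)
    case (Xbar a g)
    have "span 1 (\<lambda>x. 1 + (-1) * complex_of_real (val x (X a g)))"
      by (intro span_add span_scale span_const val_X)
    moreover have "complex_of_real (val x v) = 1 + (-1) * complex_of_real (val x (X a g))" for x
      by (simp add: Xbar val_def)
    ultimately show ?thesis
      by simp
  qed (use val_X in simp)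
  show False
  proof (rule no_PC_refutation[OF ref val_span])
    fix P x assume "P \<in> PC_axioms {..<n} (carrier G)"
    then show "peval (val x) P = 0"
      by (auto simp: PC_axioms_def peval_diff peval_add peval_power val_def)
  next
    show "5 * (2 * PC_degree ps + 1) \<le> s"
      using s by (simp add: d_def)
  next
    fix P assume "P \<in> EQ (lin_vocab G) lin_arity (lin_instance G n m col (\<lambda>i. h [^] b i)) (lin_template G)"
    then consider
        (total) a where "a < n" "P = (\<Prod>g\<in>carrier G. pvar (Xbar a g))"
      | (unique) a g g' where "g \<noteq> g'" "P = pvar (X a g) * pvar (X a g')"
      | (rel) i gs where "i < m" "length gs = 3" "set gs \<subseteq> carrier G" "gs \<notin> lin_rel G 1 1 1 (h [^] b i)"
          "P = (\<Prod>j<3. pvar (X ([col (i, 0), col (i, 1), col (i, 2)] ! j) (gs ! j)))"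
      unfolding EQ_def lin_instance_def lin_template_def lin_arity_def by auto
    then show "good (PC_degree ps) (\<lambda>x. of_real (peval (val x) P))"
    proof cases
      case total
      have "peval (val x) P = 0" for x
        using fin h(1) total by (auto simp: peval_prod val_def intro!: prod_zero)
      then show ?thesis
        by (simp add: good_def)
    next
      case unique
      have "peval (val x) P = 0" for x
        using unique by (auto simp: peval_mult val_def)
      then show ?thesis
        by (simp add: good_def)
    next
      case rel
      have col_nth: "[col (i, 0), col (i, 1), col (i, 2)] ! j = col (i, j)" if j: "j < 3" for j
      proof -
        consider "j = 0" | "j = 1" | "j = 2"
          using j by linarith
        then show ?thesis
          by cases auto
      qed
      have P: "peval (val x) P = (\<Prod>j<3. val x (X (col (i, j)) (gs ! j)))" for x
        unfolding rel(5) peval_prod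
        by (intro prod.cong) (simp_all only: col_nth peval_pvar lessThan_iff)
      show ?thesis
      \<comment> \<open>If some forbidden value is not a power of \<open>h\<close>, the product
        vanishes at every assignment considered. Otherwise its support fixes the three exponents
        modulo \<open>k\<close>, hence the value of the row character.\<close>
      proof (cases "\<forall>j<3. \<exists>e::nat. h [^] e = gs ! j")
        case False
        then obtain j where "j < 3" "\<And>e::nat. h [^] e \<noteq> gs ! j"
          by blast
        then have "peval (val x) P = 0" for x
          unfolding P by (intro prod_zero) (auto simp: val_def)
        then show ?thesis
          by (simp add: good_def)
      next
        case True
        then obtain e :: "nat \<Rightarrow> nat" where e: "\<And>j. j < 3 \<Longrightarrow> h [^] e j = gs ! j"
          by metis
        show ?thesis
        proof (rule good_axiom[where i = i and z = "\<omega> (\<Sum>j<3. int (e j))"])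
          have "span (\<Sum>j<3::nat. 1) (\<lambda>x. \<Prod>j<3. of_real (val x (X (col (i, j)) (gs ! j))))"
            by (intro span_prod val_span) auto
          then show "span 3 (\<lambda>x. of_real (peval (val x) P))"
            by (simp add: P)
        next
          fix x assume "complex_of_real (peval (val x) P) \<noteq> 0"
          then have "\<forall>j<3. val x (X (col (i, j)) (gs ! j)) \<noteq> 0"
            by (simp add: P)
          then have "int k dvd int (x (col (i, j))) - int (e j)" if "j < 3" for j
            using e[OF that] nat_pow_eq_iff[OF h(1), of "x (col (i, j))" "e j"] that
            by (auto simp: val_def k_def split: if_splits)
          then have "int k dvd (\<Sum>j<3. int (x (col (i, j))) - int (e j))"
            by (intro dvd_sum) auto
          then show "\<omega> (\<Sum>j<3. int (x (col (i, j)))) = \<omega> (\<Sum>j<3. int (e j))"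
            by (simp add: \<omega>_eq_iff sum_subtractf)
        next
          \<comment> \<open>Equality would say that the tuple \<open>gs\<close> satisfies equation
            \<open>i\<close>, contrary to its being forbidden.\<close>
          show "\<omega> (\<Sum>j<3. int (e j)) \<noteq> \<omega> (int (b i))"
          proof
            assume "\<omega> (\<Sum>j<3. int (e j)) = \<omega> (int (b i))"
            then have "int k dvd int (e 0 + e 1 + e 2) - int (b i)"
              by (simp add: \<omega>_eq_iff eval_nat_numeral)
            then have "h [^] (e 0 + e 1 + e 2) = h [^] b i"
              using nat_pow_eq_iff[OF h(1)] by (simp add: k_def)
            then have "gs ! 0 \<otimes> gs ! 1 \<otimes> gs ! 2 = h [^] b i"
              using e[of 0] e[of 1] e[of 2] h(1) by (simp flip: nat_pow_mult)
            moreover obtain g0 g1 g2 where "gs = [g0, g1, g2]"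
              using rel(2) by (auto simp: numeral_3_eq_3 length_Suc_conv)
            ultimately show False
              using rel(3,4) by (auto simp: lin_rel_111)
          qed
        qed (use rel(1) s in \<open>auto simp: d_def\<close>)
      qed
    qed
  qed
qed

end

theorem theorem6p10:
  fixes G :: "('g, 'm) monoid_scheme"
  assumes "comm_group G" and "finite (carrier G)" and "carrier G \<noteq> {\<one>\<^bsub>G\<^esub>}"
  shows "\<exists>\<delta>::real. \<delta> > 0 \<and>
    (\<exists>A :: nat \<Rightarrow> ('g list set, nat) rel_structure.
       (\<forall>n\<ge>1. is_3LIN_instance G (A n) \<and> unsatisfiable_3LIN G (A n)) \<and>
       (\<lambda>n. real (num_variables (A n))) \<in> \<Theta>(\<lambda>n. real n) \<and>
       (\<lambda>n. real (num_equations G (A n))) \<in> \<Theta>(\<lambda>n. real n) \<and>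
       (\<forall>\<^sub>F n in sequentially. \<forall>ps.
          PC_refutation (universe (A n)) (carrier G)
            (EQ (lin_vocab G) lin_arity (A n) (lin_template G)) ps
          \<longrightarrow> real (PC_degree ps) \<ge> \<delta> * real n))"
proof -
  interpret comm_group G by fact
  obtain h where h: "h \<in> carrier G" "h \<noteq> \<one>\<^bsub>G\<^esub>"
    using assms(3) one_closed by blast
  define K where "K = card (carrier G)"
  have K: "1 \<le> K"
    using assms(2) h(1) by (auto simp: K_def Suc_le_eq card_gt_0_iff)
  obtain \<delta> :: real where \<delta>: "0 < \<delta>" and ex: "\<And>n. 1 \<le> n \<Longrightarrow>
    \<exists>f \<in> {..<K * n} \<times> {..<3::nat} \<rightarrow>\<^sub>E {..<n}.
      \<forall>S\<subseteq>{..<K * n}. S \<noteq> {} \<longrightarrow> real (card S) \<le> \<delta> * real n \<longrightarrow>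
        8 * card S < 5 * card (f ` (S \<times> {..<3}))"
    using exists_expanding_incidence[OF K] by blast
  have "\<exists>col b. (\<forall>i<K * n. \<forall>j<3. col (i, j) < n) \<and>
      (\<forall>S\<subseteq>{..<K * n}. S \<noteq> {} \<longrightarrow> real (card S) \<le> \<delta> * real n \<longrightarrow>
        8 * card S < 5 * card (col ` (S \<times> {..<3::nat}))) \<and>
      unsatisfiable_3LIN G (lin_instance G n (K * n) col (\<lambda>i. h [^]\<^bsub>G\<^esub> (b i :: nat)))"
    if n: "1 \<le> n" for n
  proof -
    obtain col where col: "col \<in> {..<K * n} \<times> {..<3::nat} \<rightarrow>\<^sub>E {..<n}"
      "\<forall>S\<subseteq>{..<K * n}. S \<noteq> {} \<longrightarrow> real (card S) \<le> \<delta> * real n \<longrightarrow>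
        8 * card S < 5 * card (col ` (S \<times> {..<3}))"
      using ex[OF n] by blast
    have less: "col (i, j) < n" if "i < K * n" "j < 3" for i j
      using PiE_mem[OF col(1), of "(i, j)"] that by simp
    obtain b :: "nat \<Rightarrow> nat" where
      "unsatisfiable_3LIN G (lin_instance G n (K * n) col (\<lambda>i. h [^]\<^bsub>G\<^esub> b i))"
      using exists_unsatisfiable_rhs[OF assms(2) h n, of col] less unfolding K_def by blast
    with less col(2) show ?thesis
      by blast
  qed
  then obtain col b where
      less: "\<And>n i j. 1 \<le> n \<Longrightarrow> i < K * n \<Longrightarrow> j < 3 \<Longrightarrow> col n (i, j) < n"
    and expanding: "\<And>n S. 1 \<le> n \<Longrightarrow> S \<subseteq> {..<K * n} \<Longrightarrow> S \<noteq> {} \<Longrightarrow> real (card S) \<le> \<delta> * real n \<Longrightarrow>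
        8 * card S < 5 * card (col n ` (S \<times> {..<3::nat}))"
    and unsat: "\<And>n. 1 \<le> n \<Longrightarrow>
        unsatisfiable_3LIN G (lin_instance G n (K * n) (col n) (\<lambda>i. h [^]\<^bsub>G\<^esub> (b n i :: nat)))"
    by metis
  define A where "A n = lin_instance G n (K * n) (col n) (\<lambda>i. h [^]\<^bsub>G\<^esub> b n i)" for n
  \<comment> \<open>From here on \<open>\<delta> * n \<ge> 120\<close>: expansion then holds for
    pairs of rows, and half of \<open>\<delta> * n\<close> absorbs the additive constant 60 of
    \<open>2 * s\<close> in the degree bound.\<close>
  define n0 where "n0 = nat \<lceil>120 / \<delta>\<rceil>"
  have large: "1 \<le> n" "120 \<le> \<delta> * real n" if "n \<ge> n0 + 1" for n
  proof -
    have "120 / \<delta> \<le> real n0"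
      unfolding n0_def by (rule real_nat_ceiling_ge)
    also have "\<dots> \<le> real n"
      using that by simp
    finally show "120 \<le> \<delta> * real n"
      using \<delta> by (simp add: field_simps)
    show "1 \<le> n"
      using that by simp
  qed
  have "num_equations G (A n) = K * n" if "n \<ge> n0 + 1" for n
    unfolding A_def
  proof (rule num_equations_lin_instance)
    show "inj_on (\<lambda>i. [col n (i, 0), col n (i, 1), col n (i, 2)]) {..<K * n}"
    proof (rule inj_onI, rule ccontr)
      fix i i' assume i: "i \<in> {..<K * n}" "i' \<in> {..<K * n}" "i \<noteq> i'"
        "[col n (i, 0), col n (i, 1), col n (i, 2)] = [col n (i', 0), col n (i', 1), col n (i', 2)]"
      have three: "{..<3::nat} = {0, 1, 2}"
        by auto
      \<comment> \<open>Two rows with the same triple meet at most 3 columns, but expansion would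
        give 16 < 15.\<close>
      have "8 * card {i, i'} < 5 * card (col n ` ({i, i'} \<times> {..<3}))"
        using i large[OF that] by (intro expanding) auto
      also have "col n ` ({i, i'} \<times> {..<3}) = set [col n (i, 0), col n (i, 1), col n (i, 2)]"
        using i(4) by (auto simp: three)
      also have "card \<dots> \<le> 3"
        using card_length[of "[col n (i, 0), col n (i, 1), col n (i, 2)]"] by simp
      finally show False
        using i(3) by simp
    qed
  qed (use h(1) in simp)
  then have "\<forall>\<^sub>F n in sequentially. real (num_equations G (A n)) = real K * real n"
    unfolding eventually_sequentially by (metis of_nat_mult)
  then have eqs: "(\<lambda>n. real (num_equations G (A n))) \<in> \<Theta>(\<lambda>n. real n)"
    using K by (subst landau_theta.in_cong) auto
  have "\<delta> / 40 * real n \<le> real (PC_degree ps)"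
    if n: "n \<ge> n0 + 1" and ref: "PC_refutation (universe (A n)) (carrier G)
            (EQ (lin_vocab G) lin_arity (A n) (lin_template G)) ps" for n ps
  proof (rule ccontr)
    assume "\<not> ?thesis"
    then have small: "40 * real (PC_degree ps) < \<delta> * real n"
      by simp
    \<comment> \<open>With this \<open>s\<close> the lower bound reads \<open>s < s\<close>. It
      applies because \<open>2 * s = 20 * PC_degree ps + 60\<close>, where each summand is at most
      half of \<open>\<delta> * n\<close>.\<close>
    define s where "s = 10 * PC_degree ps + 30"
    have "real (2 * s) \<le> \<delta> * real n"
      using small large[OF n] by (simp add: s_def)
    then have "8 * card S < 5 * card (col n ` (S \<times> {..<3}))"
      if "S \<subseteq> {..<K * n}" "S \<noteq> {}" "card S \<le> 2 * s" for S
      using that by (intro expanding large(1)[OF n]) linarith+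
    moreover have "universe (A n) = {..<n}"
      by (simp add: A_def lin_instance_def)
    ultimately have "s < 10 * PC_degree ps + 30"
      using PC_degree_lower_bound[OF assms(2) h, of "K * n" "col n" n s "b n" ps]
        ref less[OF large(1)[OF n]]
      unfolding A_def by auto
    then show False
      by (simp add: s_def)
  qed
  then have "\<forall>\<^sub>F n in sequentially. \<forall>ps.
      PC_refutation (universe (A n)) (carrier G)
        (EQ (lin_vocab G) lin_arity (A n) (lin_template G)) ps
      \<longrightarrow> real (PC_degree ps) \<ge> \<delta> / 40 * real n"
    unfolding eventually_sequentially by blast
  moreover have "(\<lambda>n. real (num_variables (A n))) \<in> \<Theta>(\<lambda>n. real n)"
    by (simp add: num_variables_def A_def lin_instance_def)
  moreover have "is_3LIN_instance G (A n) \<and> unsatisfiable_3LIN G (A n)" if "n \<ge> 1" for n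
    unfolding A_def using that less unsat by (intro conjI is_3LIN_instance_lin_instance) auto
  ultimately show ?thesis
    using \<delta> eqs by (intro exI[of _ "\<delta> / 40"] conjI exI[of _ A] allI impI) auto
qed

end
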